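(* Let $0<\delta<1$, $k_0>0$, and let $0<s_0<p$ be integers. Let $A$ be a $q\times p$ real matrix satisfying the condition $\mathsf{RE}(s_0,3k_0,A)$. Let $$d = s_0+s_0\,\max_{j}\|Ae_j\|_2^2\;\frac{16K^2(s_0,3k_0,A)(3k_0)^2(3k_0+1)}{\delta^2},\qquad m=\min(d,p).$$ Let $\Psi$ be an $n\times q$ random matrix whose rows are independent isotropic $\psi_2$ random vectors in $\mathbb{R}^q$ with constant $\alpha$. Suppose that $$n\ge\frac{2000\,m\,\alpha^4}{\delta^2}\log\left(\frac{60\,e\,p}{m\,\delta}\right).$$ Then with probability at least $1-2\exp(-\delta^2n/(2000\alpha^4))$, the condition $\mathsf{RE}(s_0,k_0,(1/\sqrt n)\Psi A)$ holds for the matrix $(1/\sqrt n)\Psi A$, with $$0<K\big(s_0,k_0,(1/\sqrt n)\Psi A\big)\le\frac{K(s_0,k_0,A)}{1-\delta}.$$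
   Context: $e_1,\dots,e_p$ is the canonical basis of $\mathbb{R}^p$; for $J\subset\{1,\dots,p\}$, $J^c$ is its complement and $v_J$ is the restriction of $v\in\mathbb{R}^p$ to coordinates in $J$. Restricted Eigenvalue condition: for an integer $1\le s_0\le p$ and $k_0>0$, a matrix $A$ with $p$ columns satisfies $\mathsf{RE}(s_0,k_0,A)$ with parameter $K(s_0,k_0,A)$ if $$\frac1{K(s_0,k_0,A)}:=\min_{J\subseteq\{1,\dots,p\},\,|J|\le s_0}\ \min_{v\ne0,\ \|v_{J^c}\|_1\le k_0\|v_J\|_1}\frac{\|Av\|_2}{\|v_J\|_2}>0 .$$ A random vector $Y$ in $\mathbb{R}^q$ is isotropic if $\mathbb{E}|\langle Y,y\rangle|^2=\|y\|_2^2$ for every $y\in\mathbb{R}^q$. It is $\psi_2$ with constant $\alpha$ if for every $y\in\mathbb{R}^q$, $\|\langle Y,y\rangle\|_{\psi_2}:=\inf\{t>0:\mathbb{E}\exp(\langle Y,y\rangle^2/t^2)\le2\}\le\alpha\|y\|_2$. *)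

theory Defs
  imports "HOL-Probability.Probability"
begin

definition RE_cone :: "'p set \<Rightarrow> real \<Rightarrow> (real ^ 'p) set" where
  "RE_cone J k\<^sub>0 = {v. (\<Sum>i\<in>- J. \<bar>v $ i\<bar>) \<le> k\<^sub>0 * (\<Sum>i\<in>J. \<bar>v $ i\<bar>)}"

(* The two nested minima are taken jointly over the pairs (J, v).  This way J = {}, whose cone
   contains no nonzero vector, contributes nothing, as with the convention that a minimum over
   the empty set is infinite.  If v is a nonzero vector of the cone of J then v_J is nonzero, so
   no quotient below has denominator 0.  The infimum is a minimum when 1 <= s0 <= p: the quotient
   is homogeneous of degree 0 in v, there are finitely many J, and the unit vectors of each cone
   form a compact set. *)
definition RE_min :: "nat \<Rightarrow> real \<Rightarrow> real ^ 'p ^ 'q \<Rightarrow> real" where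
  "RE_min s\<^sub>0 k\<^sub>0 A =
     Inf {norm (A *v v) / L2_set (\<lambda>i. v $ i) J | J v. card J \<le> s\<^sub>0 \<and> v \<noteq> 0 \<and> v \<in> RE_cone J k\<^sub>0}"

definition RE :: "nat \<Rightarrow> real \<Rightarrow> real ^ 'p ^ 'q \<Rightarrow> bool" where
  "RE s\<^sub>0 k\<^sub>0 A \<longleftrightarrow> 1 \<le> s\<^sub>0 \<and> s\<^sub>0 \<le> CARD('p) \<and> 0 < k\<^sub>0 \<and> 0 < RE_min s\<^sub>0 k\<^sub>0 A"

(* Meaningful only under RE; otherwise RE_min may be 0 and the value is a junk 0. *)
definition RE_K :: "nat \<Rightarrow> real \<Rightarrow> real ^ 'p ^ 'q \<Rightarrow> real" where
  "RE_K s\<^sub>0 k\<^sub>0 A = 1 / RE_min s\<^sub>0 k\<^sub>0 A"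

(* The Bochner integral is 0 for non-integrable functions, so for y \<noteq> 0 the equation forces the
   second moment to be finite. *)
definition isotropic :: "'w measure \<Rightarrow> ('w \<Rightarrow> 'a :: euclidean_space) \<Rightarrow> bool" where
  "isotropic M Y \<longleftrightarrow> (\<forall>y. (\<integral>\<omega>. \<bar>Y \<omega> \<bullet> y\<bar>\<^sup>2 \<partial>M) = (norm y)\<^sup>2)"

(* The nonnegative integral lets the expectation be infinite, and the norm is extended-real valued
   because no t need be admissible. *)
definition psi2_norm :: "'w measure \<Rightarrow> ('w \<Rightarrow> real) \<Rightarrow> ereal" where
  "psi2_norm M X = Inf {ereal t | t. 0 < t \<and> (\<integral>\<^sup>+\<omega>. ennreal (exp ((X \<omega>)\<^sup>2 / t\<^sup>2)) \<partial>M) \<le> 2}"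

definition psi2_vector :: "'w measure \<Rightarrow> real \<Rightarrow> ('w \<Rightarrow> 'a :: euclidean_space) \<Rightarrow> bool" where
  "psi2_vector M \<alpha> Y \<longleftrightarrow> (\<forall>y. psi2_norm M (\<lambda>\<omega>. Y \<omega> \<bullet> y) \<le> ereal (\<alpha> * norm y))"

end

theory Submission imports Defs begin

text \<open>
  Only a lower bound for \<open>\<Psi>A\<close> on the cone is needed.  Bernstein's inequality for sums of squares of
  \<open>\<psi>\<^sub>2\<close> variables and a union bound over nets show that \<open>\<Psi> / \<surd>n\<close> is with high probability almost
  isometric on all images \<open>A v\<close> of vectors \<open>v\<close> with at most \<open>\<lceil>m\<rceil>\<close> nonzero coordinates.  The bound for sparse
  vectors carries over to the cone by Maurey's empirical method: the part of \<open>x\<close> outside \<open>J\<close> is the mean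
  of a random vector with \<open>\<lceil>m\<rceil> - s\<^sub>0\<close> nonzero coordinates, and averaging the squared inequality over
  this vector loses only a multiple of the square of its \<open>\<ell>\<^sub>1\<close>-norm divided by \<open>\<lceil>m\<rceil> - s\<^sub>0\<close>.  The choice
  of \<open>d\<close> makes this loss at most \<open>\<delta>\<^sup>2 / 50\<close> times the squared norm of \<open>A x\<close>.
\<close>

section \<open>Concentration of sums of squares\<close>

text \<open>Taylor series are compared termwise: for \<open>n \<ge> 2\<close> one has
  \<open>\<theta> ^ n \<le> \<theta>\<^sup>2\<close>. The first-order term stays exact, so the
  single exponential moment at \<open>\<theta> = 1\<close> controls small \<open>\<theta>\<close> of
  either sign.\<close>

lemma exp_le_quadratic_interpolation:
  fixes \<theta> t :: real
  assumes "\<bar>\<theta>\<bar> \<le> 1" "0 \<le> t"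
  shows "exp (\<theta> * t) \<le> 1 + \<theta> * t + \<theta>\<^sup>2 * (exp t - 1 - t)"
proof -
  have sm: "summable (\<lambda>n. inverse (fact (n + 2)) * x ^ (n + 2))" for x :: real
    using summable_exp[of x] by (subst summable_iff_shift) (simp add: field_simps)
  have eq: "exp x = 1 + x + (\<Sum>n. inverse (fact (n + 2)) * x ^ (n + 2))" for x :: real
    using exp_first_two_terms[of x] by (simp add: scaleR_conv_of_real)
  have "(\<Sum>n. inverse (fact (n + 2)) * (\<theta> * t) ^ (n + 2))
      \<le> (\<Sum>n. \<theta>\<^sup>2 * (inverse (fact (n + 2)) * t ^ (n + 2)))"
  proof (intro suminf_le sm summable_mult)
    fix n
    have "\<theta> ^ n \<le> 1"
      using assms(1) by (metis abs_ge_self abs_ge_zero order.trans power_abs power_le_one)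
    then have "\<theta> ^ (n + 2) \<le> \<theta>\<^sup>2"
      using mult_right_mono[of "\<theta> ^ n" 1 "\<theta>\<^sup>2"] by (simp only: power_add mult_1) simp
    then have "inverse (fact (n + 2)) * t ^ (n + 2) * \<theta> ^ (n + 2)
        \<le> inverse (fact (n + 2)) * t ^ (n + 2) * \<theta>\<^sup>2"
      using assms(2) by (intro mult_left_mono) auto
    then show "inverse (fact (n + 2)) * (\<theta> * t) ^ (n + 2)
        \<le> \<theta>\<^sup>2 * (inverse (fact (n + 2)) * t ^ (n + 2))"
      by (simp add: power_mult_distrib mult_ac)
  qed
  also have "\<dots> = \<theta>\<^sup>2 * (exp t - 1 - t)"
    using eq[of t] by (subst suminf_mult[OF sm]) simp
  finally show ?thesis
    using eq[of "\<theta> * t"] by linarith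
qed

text \<open>The interpolation is integrated at \<open>t = (X \<omega>)\<^sup>2 / a\<^sup>2\<close>.
  Since the exponential moment is at most 2, the coefficient of \<open>\<theta>\<^sup>2\<close> has
  mean at most 1.\<close>

lemma (in prob_space) nn_integral_exp_square_le:
  fixes X :: "'a \<Rightarrow> real"
  assumes [measurable]: "X \<in> borel_measurable M"
    and var: "integrable M (\<lambda>\<omega>. (X \<omega>)\<^sup>2)" "(\<integral>\<omega>. (X \<omega>)\<^sup>2 \<partial>M) = 1"
    and psi2: "(\<integral>\<^sup>+\<omega>. ennreal (exp ((X \<omega>)\<^sup>2 / a\<^sup>2)) \<partial>M) \<le> 2"
    and \<theta>: "\<bar>\<theta>\<bar> \<le> 1"
  shows "(\<integral>\<^sup>+\<omega>. ennreal (exp (\<theta> * (X \<omega>)\<^sup>2 / a\<^sup>2)) \<partial>M) \<le> ennreal (exp (\<theta> / a\<^sup>2 + \<theta>\<^sup>2))"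
proof -
  define T where "T \<omega> = (X \<omega>)\<^sup>2 / a\<^sup>2" for \<omega>
  let ?g = "\<lambda>\<omega>. 1 + \<theta> * T \<omega> + \<theta>\<^sup>2 * (exp (T \<omega>) - 1 - T \<omega>)"
  have iT: "integrable M T" and eT: "(\<integral>\<omega>. T \<omega> \<partial>M) = 1 / a\<^sup>2"
    using var by (auto simp: T_def[abs_def])
  have iE: "integrable M (\<lambda>\<omega>. exp (T \<omega>))"
    using psi2 by (intro integrableI_nonneg) (auto simp: T_def intro: order_le_less_trans)
  have "ennreal (\<integral>\<omega>. exp (T \<omega>) \<partial>M) \<le> ennreal 2"
    using psi2 by (subst nn_integral_eq_integral[symmetric, OF iE]) (auto simp: T_def)
  then have eE: "(\<integral>\<omega>. exp (T \<omega>) \<partial>M) \<le> 2"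
    by (subst (asm) ennreal_le_iff) auto
  have g: "exp (\<theta> * T \<omega>) \<le> ?g \<omega>" for \<omega>
    by (rule exp_le_quadratic_interpolation[OF \<theta>]) (simp add: T_def)
  have "(\<integral>\<^sup>+\<omega>. ennreal (exp (\<theta> * (X \<omega>)\<^sup>2 / a\<^sup>2)) \<partial>M) \<le> (\<integral>\<^sup>+\<omega>. ennreal (?g \<omega>) \<partial>M)"
    using g by (intro nn_integral_mono ennreal_leI) (simp add: T_def)
  also have "\<dots> = ennreal (\<integral>\<omega>. ?g \<omega> \<partial>M)"
  proof (rule nn_integral_eq_integral)
    show "integrable M ?g"
      by (intro Bochner_Integration.integrable_add Bochner_Integration.integrable_diff
          integrable_mult_right iT iE) simp_all
    show "AE \<omega> in M. 0 \<le> ?g \<omega>"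
      by (rule AE_I2, rule order_trans[OF exp_ge_zero g])
  qed
  also have "(\<integral>\<omega>. ?g \<omega> \<partial>M) = 1 + \<theta> / a\<^sup>2 + \<theta>\<^sup>2 * ((\<integral>\<omega>. exp (T \<omega>) \<partial>M) - 1 - 1 / a\<^sup>2)"
  proof -
    have "?g = (\<lambda>\<omega>. (1 - \<theta>\<^sup>2) + (\<theta> - \<theta>\<^sup>2) * T \<omega> + \<theta>\<^sup>2 * exp (T \<omega>))"
      by (simp add: algebra_simps)
    then have "(\<integral>\<omega>. ?g \<omega> \<partial>M) = (1 - \<theta>\<^sup>2) + (\<theta> - \<theta>\<^sup>2) * (1 / a\<^sup>2) + \<theta>\<^sup>2 * (\<integral>\<omega>. exp (T \<omega>) \<partial>M)"
      using iT iE eT prob_space by simp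
    also have "\<dots> = 1 + \<theta> / a\<^sup>2 + \<theta>\<^sup>2 * ((\<integral>\<omega>. exp (T \<omega>) \<partial>M) - 1 - 1 / a\<^sup>2)"
      by (simp add: diff_divide_distrib left_diff_distrib right_diff_distrib)
    finally show ?thesis .
  qed
  also have "\<dots> \<le> 1 + (\<theta> / a\<^sup>2 + \<theta>\<^sup>2)"
  proof -
    have "0 \<le> 1 / a\<^sup>2" by simp
    with eE have "\<theta>\<^sup>2 * ((\<integral>\<omega>. exp (T \<omega>) \<partial>M) - 1 - 1 / a\<^sup>2) \<le> \<theta>\<^sup>2 * 1"
      by (intro mult_left_mono) (linarith, simp)
    then show ?thesis by simp
  qed
  also have "\<dots> \<le> exp (\<theta> / a\<^sup>2 + \<theta>\<^sup>2)"
    by (rule exp_ge_add_one_self)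
  finally show ?thesis
    by (simp add: ennreal_leI)
qed

text \<open>Exponential Markov inequality for independent summands; the sign \<open>s\<close>
  selects the upper or the lower tail.\<close>

lemma (in prob_space) square_sum_tail:
  fixes X :: "'i \<Rightarrow> 'a \<Rightarrow> real" and a s \<epsilon> :: real
  assumes I: "finite I" and ind: "indep_vars (\<lambda>_. borel) X I"
    and var: "\<And>i. i \<in> I \<Longrightarrow> integrable M (\<lambda>\<omega>. (X i \<omega>)\<^sup>2)" "\<And>i. i \<in> I \<Longrightarrow> (\<integral>\<omega>. (X i \<omega>)\<^sup>2 \<partial>M) = 1"
    and psi2: "\<And>i. i \<in> I \<Longrightarrow> (\<integral>\<^sup>+\<omega>. ennreal (exp ((X i \<omega>)\<^sup>2 / a\<^sup>2)) \<partial>M) \<le> 2"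
    and \<epsilon>: "0 \<le> \<epsilon>" "\<epsilon> \<le> 2" and a: "1 \<le> a" and s: "\<bar>s\<bar> = 1"
  shows "prob {\<omega> \<in> space M. \<epsilon> * card I \<le> s * ((\<Sum>i\<in>I. (X i \<omega>)\<^sup>2) - card I)}
    \<le> exp (- (card I * \<epsilon>\<^sup>2 / (4 * a ^ 4)))"
proof -
  have [measurable]: "X i \<in> borel_measurable M" if "i \<in> I" for i
    using ind that by (auto simp: indep_vars_def)
  have ss: "s * s = 1" using s by (metis abs_mult_self_eq mult_1)
  \<comment> \<open>This value minimises the exponent
    \<open>\<theta>\<^sup>2 - s * \<theta> * \<epsilon> / a\<^sup>2\<close> of one summand, with
    minimum \<open>- (\<epsilon>\<^sup>2 / (4 * a ^ 4))\<close>. The bounds on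
    \<open>\<epsilon>\<close> and \<open>a\<close> keep
    \<open>\<bar>\<theta>\<bar> \<le> 1\<close>.\<close>
  define \<theta> where "\<theta> = s * \<epsilon> / (2 * a\<^sup>2)"
  define f where "f i \<omega> = exp (\<theta> * (X i \<omega>)\<^sup>2 / a\<^sup>2 - \<theta> / a\<^sup>2 - s * \<theta> * \<epsilon> / a\<^sup>2)" for i \<omega>
  define A where "A = {\<omega> \<in> space M. \<epsilon> * card I \<le> s * ((\<Sum>i\<in>I. (X i \<omega>)\<^sup>2) - card I)}"
  have a0: "a \<noteq> 0" using a by simp
  have a2: "1 \<le> a\<^sup>2" using a by (simp add: one_le_power)
  have \<theta>1: "\<bar>\<theta>\<bar> \<le> 1"
  proof -
    have "\<bar>\<theta>\<bar> = \<epsilon> / (2 * a\<^sup>2)"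
      using s \<epsilon> by (simp add: \<theta>_def abs_mult)
    also have "\<dots> \<le> 1" using \<epsilon> a2 by (simp add: divide_le_eq)
    finally show ?thesis .
  qed
  have Am: "A \<in> sets M" unfolding A_def by measurable
  have "indep_vars (\<lambda>_. borel) (\<lambda>i. (\<lambda>x. ennreal (exp (\<theta> * x\<^sup>2 / a\<^sup>2 - \<theta> / a\<^sup>2 - s * \<theta> * \<epsilon> / a\<^sup>2))) \<circ> X i) I"
    by (rule indep_vars_compose[OF ind]) auto
  then have ind': "indep_vars (\<lambda>_. borel) (\<lambda>i \<omega>. ennreal (f i \<omega>)) I"
    by (simp add: f_def comp_def)
  \<comment> \<open>On the tail event the exponents add up to a nonnegative number, so the product
    dominates the indicator of \<open>A\<close>.\<close>
  have one: "1 \<le> (\<Prod>i\<in>I. f i \<omega>)" if "\<omega> \<in> A" for \<omega>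
  proof -
    have "(\<Sum>i\<in>I. \<theta> * (X i \<omega>)\<^sup>2 / a\<^sup>2 - \<theta> / a\<^sup>2 - s * \<theta> * \<epsilon> / a\<^sup>2)
        = \<theta> / a\<^sup>2 * ((\<Sum>i\<in>I. (X i \<omega>)\<^sup>2) - card I) - s * \<theta> / a\<^sup>2 * (\<epsilon> * card I)"
      by (simp add: sum_subtractf sum_distrib_left sum_divide_distrib algebra_simps)
    also have "\<dots> = \<epsilon> / (2 * a\<^sup>2) / a\<^sup>2 * (s * ((\<Sum>i\<in>I. (X i \<omega>)\<^sup>2) - card I) - (s * s) * (\<epsilon> * card I))"
      using a0 by (simp add: \<theta>_def field_simps)
    also have "\<dots> \<ge> 0"
      using that \<epsilon> ss unfolding A_def by (intro mult_nonneg_nonneg) auto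
    finally show ?thesis
      unfolding f_def by (subst exp_sum[symmetric, OF I]) simp
  qed
  have fi: "(\<integral>\<^sup>+\<omega>. ennreal (f i \<omega>) \<partial>M) \<le> ennreal (exp (- (\<epsilon>\<^sup>2 / (4 * a ^ 4))))" if "i \<in> I" for i
  proof -
    let ?c = "exp (- \<theta> / a\<^sup>2 - s * \<theta> * \<epsilon> / a\<^sup>2)"
    have "(\<integral>\<^sup>+\<omega>. ennreal (f i \<omega>) \<partial>M) = (\<integral>\<^sup>+\<omega>. ennreal ?c * ennreal (exp (\<theta> * (X i \<omega>)\<^sup>2 / a\<^sup>2)) \<partial>M)"
      by (intro nn_integral_cong) (simp add: f_def ennreal_mult'[symmetric] exp_add[symmetric] algebra_simps)
    also have "\<dots> = ennreal ?c * (\<integral>\<^sup>+\<omega>. ennreal (exp (\<theta> * (X i \<omega>)\<^sup>2 / a\<^sup>2)) \<partial>M)"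
      using that by (intro nn_integral_cmult) measurable
    also have "\<dots> \<le> ennreal ?c * ennreal (exp (\<theta> / a\<^sup>2 + \<theta>\<^sup>2))"
      using that var psi2 \<theta>1 by (intro mult_left_mono nn_integral_exp_square_le) auto
    also have "\<dots> = ennreal (exp (\<theta>\<^sup>2 - s * \<theta> * \<epsilon> / a\<^sup>2))"
      by (simp add: ennreal_mult'[symmetric] exp_add[symmetric])
    also have "\<theta>\<^sup>2 - s * \<theta> * \<epsilon> / a\<^sup>2 = (s * s) * \<epsilon>\<^sup>2 / (4 * a ^ 4) - (s * s) * \<epsilon>\<^sup>2 / (2 * a ^ 4)"
      unfolding \<theta>_def by (simp add: power_divide power_mult_distrib power2_eq_square power4_eq_xxxx mult_ac)
    also have "\<dots> = - (\<epsilon>\<^sup>2 / (4 * a ^ 4))"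
      by (simp add: ss field_simps)
    finally show ?thesis .
  qed
  have "emeasure M A = (\<integral>\<^sup>+\<omega>. indicator A \<omega> \<partial>M)"
    using Am by simp
  also have "\<dots> \<le> (\<integral>\<^sup>+\<omega>. (\<Prod>i\<in>I. ennreal (f i \<omega>)) \<partial>M)"
    using one by (intro nn_integral_mono) (auto simp: f_def prod_ennreal ennreal_1[symmetric] simp del: ennreal_1 split: split_indicator intro!: ennreal_leI)
  also have "\<dots> = (\<Prod>i\<in>I. \<integral>\<^sup>+\<omega>. ennreal (f i \<omega>) \<partial>M)"
    by (rule indep_vars_nn_integral[OF I ind']) simp
  also have "\<dots> \<le> (\<Prod>i\<in>I. ennreal (exp (- (\<epsilon>\<^sup>2 / (4 * a ^ 4)))))"
    by (intro prod_mono_ennreal fi)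
  also have "\<dots> = ennreal (exp (- (card I * \<epsilon>\<^sup>2 / (4 * a ^ 4))))"
    by (simp add: ennreal_power exp_of_nat_mult[symmetric])
  finally show ?thesis
    unfolding A_def[symmetric] by (simp add: emeasure_eq_measure)
qed

section \<open>Isotropic vectors with bounded \<open>psi2_norm\<close> in every direction\<close>

lemma psi2_norm_less_imp:
  assumes "psi2_norm M X < ereal a"
  shows "(\<integral>\<^sup>+\<omega>. ennreal (exp ((X \<omega>)\<^sup>2 / a\<^sup>2)) \<partial>M) \<le> 2"
proof -
  obtain t where t: "0 < t" "t < a" "(\<integral>\<^sup>+\<omega>. ennreal (exp ((X \<omega>)\<^sup>2 / t\<^sup>2)) \<partial>M) \<le> 2"
    using assms by (auto simp: psi2_norm_def Inf_less_iff)
  have "(\<integral>\<^sup>+\<omega>. ennreal (exp ((X \<omega>)\<^sup>2 / a\<^sup>2)) \<partial>M) \<le> (\<integral>\<^sup>+\<omega>. ennreal (exp ((X \<omega>)\<^sup>2 / t\<^sup>2)) \<partial>M)"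
    using t by (intro nn_integral_mono ennreal_leI iffD2[OF exp_le_cancel_iff] divide_left_mono power_mono) auto
  with t show ?thesis by simp
qed

text \<open>Take expectations in \<open>1 + x \<le> exp x\<close> at
  \<open>x = (X \<omega>)\<^sup>2 / a\<^sup>2\<close>.\<close>

lemma (in prob_space) second_moment_le_of_psi2:
  fixes X :: "'a \<Rightarrow> real"
  assumes [measurable]: "X \<in> borel_measurable M"
    and var: "integrable M (\<lambda>\<omega>. (X \<omega>)\<^sup>2)"
    and psi2: "(\<integral>\<^sup>+\<omega>. ennreal (exp ((X \<omega>)\<^sup>2 / a\<^sup>2)) \<partial>M) \<le> 2"
    and a: "a \<noteq> 0"
  shows "(\<integral>\<omega>. (X \<omega>)\<^sup>2 \<partial>M) \<le> a\<^sup>2"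
proof -
  have "ennreal (\<integral>\<omega>. 1 + (X \<omega>)\<^sup>2 / a\<^sup>2 \<partial>M) = (\<integral>\<^sup>+\<omega>. ennreal (1 + (X \<omega>)\<^sup>2 / a\<^sup>2) \<partial>M)"
    using var by (intro nn_integral_eq_integral[symmetric]) auto
  also have "\<dots> \<le> (\<integral>\<^sup>+\<omega>. ennreal (exp ((X \<omega>)\<^sup>2 / a\<^sup>2)) \<partial>M)"
    by (intro nn_integral_mono ennreal_leI exp_ge_add_one_self)
  also have "\<dots> \<le> ennreal 2" using psi2 by simp
  finally have "(\<integral>\<omega>. 1 + (X \<omega>)\<^sup>2 / a\<^sup>2 \<partial>M) \<le> 2"
    by (subst (asm) ennreal_le_iff) auto
  then show ?thesis
    using var a prob_space by (simp add: field_simps)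
qed

lemma isotropic_unit:
  assumes "isotropic M Y" "norm u = 1"
  shows "integrable M (\<lambda>\<omega>. (Y \<omega> \<bullet> u)\<^sup>2)" "(\<integral>\<omega>. (Y \<omega> \<bullet> u)\<^sup>2 \<partial>M) = 1"
proof -
  show *: "(\<integral>\<omega>. (Y \<omega> \<bullet> u)\<^sup>2 \<partial>M) = 1"
    using assms by (simp add: isotropic_def)
  \<comment> \<open>A non-integrable function would have Bochner integral 0, not 1.\<close>
  show "integrable M (\<lambda>\<omega>. (Y \<omega> \<bullet> u)\<^sup>2)"
    by (rule ccontr) (use * not_integrable_integral_eq in force)
qed

text \<open>A constant below 1 would leave room for some \<open>a < 1\<close> that bounds the second
  moment in a unit direction by \<open>a\<^sup>2\<close>, while isotropy makes that moment
  1.\<close>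

lemma (in prob_space) psi2_vector_constant_ge_1:
  fixes Y :: "'a \<Rightarrow> 'b :: euclidean_space"
  assumes "Y \<in> borel_measurable M" "isotropic M Y" "psi2_vector M \<alpha> Y"
  shows "1 \<le> \<alpha>"
proof (rule ccontr)
  assume "\<not> 1 \<le> \<alpha>"
  then obtain a where a: "0 < a" "\<alpha> < a" "a < 1"
    using dense[of "max 0 \<alpha>" 1] by auto
  obtain u :: 'b where u: "norm u = 1"
    using vector_choose_size zero_le_one by blast
  have "psi2_norm M (\<lambda>\<omega>. Y \<omega> \<bullet> u) \<le> ereal \<alpha>"
    using assms(3) u by (auto simp: psi2_vector_def dest: spec[of _ u])
  also have "\<dots> < ereal a" using a by simp
  finally have "(\<integral>\<omega>. (Y \<omega> \<bullet> u)\<^sup>2 \<partial>M) \<le> a\<^sup>2"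
    using assms(1) a isotropic_unit[OF assms(2) u]
    by (intro second_moment_le_of_psi2 psi2_norm_less_imp) auto
  with isotropic_unit[OF assms(2) u] have "1 \<le> a\<^sup>2" by simp
  moreover have "a\<^sup>2 < 1" using a by (simp add: abs_square_less_1)
  ultimately show False by simp
qed

text \<open>By homogeneity \<open>u\<close> may be normalised, and the event is the union of the two
  tails. For \<open>u = 0\<close> the non-strict inequality would hold everywhere, hence
  \<open>u \<noteq> 0\<close>.\<close>

lemma (in prob_space) psi2_concentration:
  fixes Y :: "'i \<Rightarrow> 'a \<Rightarrow> 'b :: euclidean_space" and \<epsilon> a :: real
  assumes I: "finite I" and ind: "indep_vars (\<lambda>_. borel) Y I"
    and iso: "\<And>i. i \<in> I \<Longrightarrow> isotropic M (Y i)"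
    and psi2: "\<And>i. i \<in> I \<Longrightarrow> psi2_vector M \<alpha> (Y i)"
    and \<epsilon>: "0 \<le> \<epsilon>" "\<epsilon> \<le> 2" and a: "1 \<le> a" "\<alpha> < a" and u: "u \<noteq> 0"
  shows "prob {\<omega> \<in> space M. \<epsilon> * card I * (norm u)\<^sup>2 \<le> \<bar>(\<Sum>i\<in>I. (Y i \<omega> \<bullet> u)\<^sup>2) - card I * (norm u)\<^sup>2\<bar>}
    \<le> 2 * exp (- (card I * \<epsilon>\<^sup>2 / (4 * a ^ 4)))"
proof -
  define v where "v = u /\<^sub>R norm u"
  have v: "norm v = 1" and uv: "u = norm u *\<^sub>R v" using u by (auto simp: v_def)
  define S where "S \<omega> = (\<Sum>i\<in>I. (Y i \<omega> \<bullet> v)\<^sup>2)" for \<omega>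
  define T where "T s = {\<omega> \<in> space M. \<epsilon> * card I \<le> s * (S \<omega> - card I)}" for s :: real
  have [measurable]: "Y i \<in> borel_measurable M" if "i \<in> I" for i
    using ind that by (auto simp: indep_vars_def)
  have T: "T s \<in> sets M" for s unfolding T_def S_def by measurable
  have ind': "indep_vars (\<lambda>_. borel) (\<lambda>i \<omega>. Y i \<omega> \<bullet> v) I"
    by (rule indep_vars_compose2[OF ind]) auto
  have "psi2_norm M (\<lambda>\<omega>. Y i \<omega> \<bullet> v) < ereal a" if "i \<in> I" for i
    using psi2[OF that] v a by (auto simp: psi2_vector_def dest!: spec[of _ v] intro: order_le_less_trans)
  then have tail: "prob (T s) \<le> exp (- (card I * \<epsilon>\<^sup>2 / (4 * a ^ 4)))" if "\<bar>s\<bar> = 1" for s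
    unfolding T_def S_def
    using that v \<epsilon> a by (intro square_sum_tail I ind' isotropic_unit[OF iso] psi2_norm_less_imp) auto
  have "(\<Sum>i\<in>I. (Y i \<omega> \<bullet> u)\<^sup>2) = (norm u)\<^sup>2 * S \<omega>" for \<omega>
    by (subst uv) (simp add: S_def sum_distrib_left power_mult_distrib)
  then have "\<bar>(\<Sum>i\<in>I. (Y i \<omega> \<bullet> u)\<^sup>2) - card I * (norm u)\<^sup>2\<bar> = (norm u)\<^sup>2 * \<bar>S \<omega> - card I\<bar>" for \<omega>
    by (simp add: abs_mult flip: right_diff_distrib mult.commute[of "(norm u)\<^sup>2"])
  then have "{\<omega> \<in> space M. \<epsilon> * card I * (norm u)\<^sup>2 \<le> \<bar>(\<Sum>i\<in>I. (Y i \<omega> \<bullet> u)\<^sup>2) - card I * (norm u)\<^sup>2\<bar>} = T 1 \<union> T (- 1)"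
    using u by (auto simp: T_def mult.commute[of _ "(norm u)\<^sup>2"])
  then show ?thesis
    using measure_Un_le[OF T T, of 1 "- 1"] tail[of 1] tail[of "- 1"] by simp
qed

section \<open>Nets of subspaces\<close>

text \<open>The sum is 1 plus twice a geometric series, bounded by means of
  \<open>(1 + \<eta>) * exp (- \<eta>) \<le> 1\<close>.\<close>

lemma sum_exp_neg_abs_le:
  fixes \<eta> :: real
  assumes "0 < \<eta>"
  shows "(\<Sum>z\<in>{- int N..int N}. exp (- \<eta> * \<bar>real_of_int z\<bar>)) \<le> 1 + 2 / \<eta>"
proof -
  let ?f = "\<lambda>z. exp (- \<eta> * \<bar>real_of_int z\<bar>)"
  have eq: "(\<Sum>z\<in>{- int N..int N}. ?f z) = 1 + 2 * (\<Sum>k=1..N. exp (- \<eta>) ^ k)"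
  proof (induction N)
    case (Suc N)
    have "{- int (Suc N)..int (Suc N)} = insert (int (Suc N)) (insert (- int (Suc N)) {- int N..int N})"
      by auto
    moreover have "exp (- \<eta>) ^ Suc N = ?f (int (Suc N))" "?f (- int (Suc N)) = ?f (int (Suc N))"
      by (simp_all add: exp_of_nat_mult[symmetric] del: power_Suc)
    ultimately show ?case using Suc by (simp del: power_Suc)
  qed simp
  \<comment> \<open>Keeping \<open>exp (- \<eta>) ^ N\<close> on the right makes the induction
    telescope.\<close>
  have "\<eta> * (\<Sum>k=1..N. exp (- \<eta>) ^ k) \<le> 1 - exp (- \<eta>) ^ N"
  proof (induction N)
    case (Suc N)
    have "(1 + \<eta>) * exp (- \<eta>) \<le> exp \<eta> * exp (- \<eta>)"
      by (intro mult_right_mono exp_ge_add_one_self) auto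
    then have "(1 + \<eta>) * exp (- \<eta>) \<le> 1" by (simp add: exp_minus)
    then have "exp (- \<eta>) ^ N * ((1 + \<eta>) * exp (- \<eta>)) \<le> exp (- \<eta>) ^ N * 1"
      by (intro mult_left_mono) auto
    with Suc show ?case by (simp add: algebra_simps)
  qed simp
  also have "\<dots> \<le> 1" by simp
  finally show ?thesis using assms unfolding eq by (simp add: field_simps)
qed

text \<open>The weight \<open>exp (1 - \<eta> * s / card B)\<close> of a point of \<open>\<ell>\<^sub>1\<close>-norm \<open>s\<close> is at least 1 on the counted set,
  and its total mass factorises.\<close>
lemma card_integer_l1_ball_le:
  fixes \<eta> :: real
  assumes B: "finite B" and \<eta>: "0 < \<eta>"
  defines "Z \<equiv> {z \<in> B \<rightarrow>\<^sub>E (UNIV :: int set). \<eta> * (\<Sum>b\<in>B. \<bar>real_of_int (z b)\<bar>) \<le> card B}"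
  shows "finite Z" "card Z \<le> (exp 1 * (1 + 2 / \<eta>)) ^ card B"
proof -
  \<comment> \<open>No coordinate of a counted point exceeds \<open>N\<close>, so the sum over all
    integer points may be replaced by one over a finite box.\<close>
  define N where "N = nat \<lceil>card B / \<eta>\<rceil>"
  let ?P = "B \<rightarrow>\<^sub>E {- int N..int N}"
  let ?w = "\<lambda>z. \<Prod>b\<in>B. exp 1 * exp (- \<eta> * \<bar>real_of_int (z b)\<bar>)"
  have finP: "finite ?P" using B by (intro finite_PiE) auto
  have sub: "Z \<subseteq> ?P"
  proof
    fix z assume z: "z \<in> Z"
    have "\<bar>z b\<bar> \<le> int N" if "b \<in> B" for b
    proof -
      have "\<eta> * \<bar>real_of_int (z b)\<bar> \<le> \<eta> * (\<Sum>b\<in>B. \<bar>real_of_int (z b)\<bar>)"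
        using that B \<eta> by (intro mult_left_mono member_le_sum) auto
      also have "\<dots> \<le> card B" using z by (simp add: Z_def)
      finally have "\<bar>real_of_int (z b)\<bar> \<le> card B / \<eta>" using \<eta> by (simp add: field_simps)
      also have "\<dots> \<le> real N" unfolding N_def by (rule real_nat_ceiling_ge)
      finally show ?thesis by linarith
    qed
    then show "z \<in> ?P" using z by (force simp: Z_def PiE_iff)
  qed
  then show "finite Z" using finP finite_subset by blast
  have "1 \<le> ?w z" if "z \<in> Z" for z
  proof -
    have "?w z = exp (\<Sum>b\<in>B. 1 + (- \<eta> * \<bar>real_of_int (z b)\<bar>))"
      using B by (simp only: exp_sum exp_add)
    also have "(\<Sum>b\<in>B. 1 + (- \<eta> * \<bar>real_of_int (z b)\<bar>)) = card B - \<eta> * (\<Sum>b\<in>B. \<bar>real_of_int (z b)\<bar>)"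
      by (simp add: sum_subtractf sum_distrib_left)
    finally show ?thesis using that by (simp add: Z_def)
  qed
  then have "real (card Z) \<le> (\<Sum>z\<in>Z. ?w z)"
    using sum_mono[of Z "\<lambda>_. 1" ?w] by simp
  also have "\<dots> \<le> (\<Sum>z\<in>?P. ?w z)"
    using finP sub by (intro sum_mono2 prod_nonneg) auto
  also have "\<dots> = (\<Prod>b\<in>B. \<Sum>z\<in>{- int N..int N}. exp 1 * exp (- \<eta> * \<bar>real_of_int z\<bar>))"
    using B by (intro prod_sum_PiE[symmetric]) auto
  also have "\<dots> = (exp 1 * (\<Sum>z\<in>{- int N..int N}. exp (- \<eta> * \<bar>real_of_int z\<bar>))) ^ card B"
    by (simp add: sum_distrib_left)
  also have "\<dots> \<le> (exp 1 * (1 + 2 / \<eta>)) ^ card B"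
    by (intro power_mono mult_left_mono sum_exp_neg_abs_le \<eta> mult_nonneg_nonneg sum_nonneg) auto
  finally show "card Z \<le> (exp 1 * (1 + 2 / \<eta>)) ^ card B" .
qed

lemma orthonormal_expansion:
  fixes B :: "'a :: euclidean_space set"
  assumes "pairwise orthogonal B" "\<And>b. b \<in> B \<Longrightarrow> norm b = 1" "finite B"
  shows "u \<in> span B \<Longrightarrow> (\<Sum>b\<in>B. (u \<bullet> b) *\<^sub>R b) = u"
    and "(norm (\<Sum>b\<in>B. c b *\<^sub>R b))\<^sup>2 = (\<Sum>b\<in>B. (c b)\<^sup>2)"
proof -
  have ip: "b \<bullet> b' = (if b = b' then 1 else 0)" if "b \<in> B" "b' \<in> B" for b b'
    using assms(1) assms(2)[of b] that by (auto simp: pairwise_def orthogonal_def dot_square_norm)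
  show "(norm (\<Sum>b\<in>B. c b *\<^sub>R b))\<^sup>2 = (\<Sum>b\<in>B. (c b)\<^sup>2)"
    using assms(3)
    by (subst norm_sum_Pythagorean)
      (auto simp: assms(2) power_mult_distrib pairwise_def orthogonal_def ip)
  show "(\<Sum>b\<in>B. (u \<bullet> b) *\<^sub>R b) = u" if "u \<in> span B"
    using that assms(3)
  proof -
    obtain c where u: "u = (\<Sum>b\<in>B. c b *\<^sub>R b)"
      using \<open>u \<in> span B\<close> assms(3) by (auto simp: span_finite)
    have "u \<bullet> b = c b" if "b \<in> B" for b
    proof -
      have "u \<bullet> b = (\<Sum>b'\<in>B. if b' = b then c b else 0)"
        unfolding u inner_sum_left using that by (intro sum.cong) (auto simp: ip)
      then show ?thesis using that assms(3) by simp
    qed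
    then show ?thesis by (subst (2) u) simp
  qed
qed

text \<open>In orthonormal coordinates the net is a grid. Cauchy-Schwarz puts the grid points
  obtained by rounding the unit ball into an integer ball for the l1-norm, which the preceding count
  bounds.\<close>

lemma subspace_net:
  fixes W :: "'a :: euclidean_space set" and \<eta> :: real
  assumes W: "subspace W" and dim: "dim W \<le> k" and \<eta>: "0 < \<eta>"
  obtains N where "finite N" "N \<subseteq> W" "card N \<le> (exp 1 * (1 + 2 / \<eta>)) ^ k"
    "\<And>u. u \<in> W \<Longrightarrow> norm u \<le> 1 \<Longrightarrow> \<exists>g\<in>N. norm g \<le> 1 \<and> norm (u - g) \<le> \<eta>"
proof -
  obtain B where B: "B \<subseteq> W" "pairwise orthogonal B" "\<And>b. b \<in> B \<Longrightarrow> norm b = 1"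
      "independent B" "card B = dim W" "span B = W"
    using orthonormal_basis_subspace[OF W] by metis
  have fin: "finite B" using B(4) independent_imp_finite by blast
  note on = orthonormal_expansion[OF B(2,3) fin]
  \<comment> \<open>A coordinate error of at most \<open>h\<close> in each of \<open>card B\<close>
    directions gives total error at most \<open>\<eta>\<close>. If \<open>B\<close> is empty then
    \<open>h = 0\<close>, but all sums are empty as well.\<close>
  define h where "h = \<eta> / sqrt (card B)"
  define Z where "Z = {z \<in> B \<rightarrow>\<^sub>E (UNIV :: int set). \<eta> * (\<Sum>b\<in>B. \<bar>real_of_int (z b)\<bar>) \<le> card B}"
  define G where "G z = (\<Sum>b\<in>B. (h * real_of_int (z b)) *\<^sub>R b)" for z
  have Z: "finite Z" "card Z \<le> (exp 1 * (1 + 2 / \<eta>)) ^ card B"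
    using card_integer_l1_ball_le[OF fin \<eta>] by (auto simp: Z_def)
  show thesis
  proof (rule that[of "G ` Z"])
    show "finite (G ` Z)" using Z by simp
    show "G ` Z \<subseteq> W"
      using B(1) W by (auto simp: G_def intro!: subspace_sum subspace_scale)
    have "1 * 1 \<le> exp 1 * (1 + 2 / \<eta>)" using \<eta> by (intro mult_mono) auto
    then have "(exp 1 * (1 + 2 / \<eta>)) ^ card B \<le> (exp 1 * (1 + 2 / \<eta>)) ^ k"
      using B(5) dim by (intro power_increasing) auto
    with card_image_le[OF Z(1), of G] Z(2) show "card (G ` Z) \<le> (exp 1 * (1 + 2 / \<eta>)) ^ k"
      by linarith
    fix u assume u: "u \<in> W" "norm u \<le> 1"
    \<comment> \<open>Rounding towards zero does not increase any coordinate in absolute value, so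
      the grid point stays in the unit ball.\<close>
    define t where "t b = (if u \<bullet> b \<ge> 0 then \<lfloor>u \<bullet> b / h\<rfloor> else \<lceil>u \<bullet> b / h\<rceil>)" for b
    define z where "z = restrict t B"
    have ueq: "u = (\<Sum>b\<in>B. (u \<bullet> b) *\<^sub>R b)" using on(1) u(1) B(6) by simp
    have sq: "(\<Sum>b\<in>B. (u \<bullet> b)\<^sup>2) \<le> 1"
      using on(2)[of "\<lambda>b. u \<bullet> b"] ueq u(2) by (metis abs_norm_cancel abs_square_le_1)
    have h: "0 < h" if "b \<in> B" for b
    proof -
      have "0 < card B" using that fin by (auto simp: card_gt_0_iff)
      then show ?thesis using \<eta> by (simp add: h_def)
    qed
    have t1: "\<bar>h * t b\<bar> \<le> \<bar>u \<bullet> b\<bar>" "\<bar>u \<bullet> b - h * t b\<bar> \<le> h" if "b \<in> B" for b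
    proof -
      define x where "x = u \<bullet> b / h"
      have x: "u \<bullet> b = h * x" using h[OF that] by (simp add: x_def)
      have "0 \<le> u \<bullet> b \<longleftrightarrow> 0 \<le> x" using h[OF that] by (simp add: x zero_le_mult_iff)
      then have t: "t b = (if 0 \<le> x then \<lfloor>x\<rfloor> else \<lceil>x\<rceil>)" by (simp add: t_def x_def)
      have "\<bar>real_of_int (t b)\<bar> \<le> \<bar>x\<bar>" "\<bar>x - t b\<bar> \<le> 1" unfolding t by (auto split: if_splits; linarith)+
      with h[OF that] show "\<bar>h * t b\<bar> \<le> \<bar>u \<bullet> b\<bar>" "\<bar>u \<bullet> b - h * t b\<bar> \<le> h"
        by (simp_all add: x abs_mult mult_left_le flip: right_diff_distrib)
    qed
    have Gz: "G z = (\<Sum>b\<in>B. (h * t b) *\<^sub>R b)" by (simp add: G_def z_def)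
    have "(norm (G z))\<^sup>2 = (\<Sum>b\<in>B. (h * t b)\<^sup>2)"
      by (simp only: Gz on(2))
    also have "\<dots> \<le> (\<Sum>b\<in>B. (u \<bullet> b)\<^sup>2)"
      using t1(1) by (intro sum_mono) (metis abs_le_square_iff)
    finally have n1: "norm (G z) \<le> 1"
      using sq power2_le_imp_le[of "norm (G z)" 1] by simp
    have "u - G z = (\<Sum>b\<in>B. (u \<bullet> b - h * t b) *\<^sub>R b)"
      unfolding Gz by (subst ueq) (simp add: sum_subtractf scaleR_left_diff_distrib)
    then have "(norm (u - G z))\<^sup>2 = (\<Sum>b\<in>B. (u \<bullet> b - h * t b)\<^sup>2)" by (simp add: on(2))
    also have "\<dots> \<le> (\<Sum>b\<in>B. h\<^sup>2)"
      using t1(2) h by (intro sum_mono) (metis abs_le_square_iff abs_of_pos)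
    also have "\<dots> \<le> \<eta>\<^sup>2" by (simp add: h_def power_divide)
    finally have n2: "norm (u - G z) \<le> \<eta>" using \<eta> by (simp add: power2_le_iff_abs_le)
    have "\<eta> * (\<Sum>b\<in>B. \<bar>real_of_int (z b)\<bar>) \<le> card B"
    proof (cases "B = {}")
      case False
      then have h0: "0 < h" and c: "0 < card B" using h fin by (auto simp: card_gt_0_iff)
      have "(\<Sum>b\<in>B. \<bar>h * t b\<bar>) \<le> (\<Sum>b\<in>B. \<bar>u \<bullet> b\<bar> * \<bar>1\<bar>)" using t1(1) by (intro sum_mono) simp
      also have "\<dots> \<le> L2_set (\<lambda>b. u \<bullet> b) B * L2_set (\<lambda>_. 1) B" by (rule L2_set_mult_ineq)
      also have "\<dots> \<le> 1 * sqrt (card B)"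
        using sq by (intro mult_mono) (auto simp: L2_set_def sum_nonneg)
      finally have "h * (\<Sum>b\<in>B. \<bar>real_of_int (t b)\<bar>) \<le> sqrt (card B)"
        using h0 by (simp add: abs_mult sum_distrib_left)
      then have "\<eta> * (\<Sum>b\<in>B. \<bar>real_of_int (t b)\<bar>) \<le> sqrt (card B) * sqrt (card B)"
        using c by (simp add: h_def divide_le_eq)
      then show ?thesis by (simp add: z_def)
    qed simp
    then have "z \<in> Z" by (simp add: Z_def z_def)
    with n1 n2 show "\<exists>g\<in>G ` Z. norm g \<le> 1 \<and> norm (u - g) \<le> \<eta>" by blast
  qed
qed

text \<open>Let \<open>L\<close> be the norm of \<open>F\<close> on \<open>W\<close>. Approximating
  a maximiser by a net point bounds \<open>L\<close> in terms of itself; with \<open>L\<close>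
  bounded, the net error in the lower estimate is also under control.\<close>

lemma net_almost_isometry:
  fixes F :: "'a :: euclidean_space \<Rightarrow> 'b :: real_normed_vector" and \<delta> :: real
  assumes F: "linear F" and W: "subspace W" and \<delta>: "0 < \<delta>" "\<delta> < 1"
    and net: "\<And>u. u \<in> W \<Longrightarrow> norm u \<le> 1 \<Longrightarrow> \<exists>g\<in>N. norm g \<le> 1 \<and> norm (u - g) \<le> \<delta> / 10"
    and N: "N \<subseteq> W" "\<And>g. g \<in> N \<Longrightarrow> \<bar>(norm (F g))\<^sup>2 - (norm g)\<^sup>2\<bar> \<le> \<delta> / 4 * (norm g)\<^sup>2"
    and u: "u \<in> W"
  shows "(1 - 19 / 40 * \<delta>) * norm u \<le> norm (F u)" "norm (F u) \<le> 5 / 4 * norm u"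
proof -
  have scale: "norm (F (t *\<^sub>R v)) = \<bar>t\<bar> * norm (F v)" for t v
    by (simp add: linear_scale[OF F])
  have Fg: "norm (F g) \<le> (1 + \<delta> / 8) * norm g" "(1 - \<delta> / 4) * norm g \<le> norm (F g)" if "g \<in> N" for g
  proof -
    have b: "(1 - \<delta> / 4) * (norm g)\<^sup>2 \<le> (norm (F g))\<^sup>2" "(norm (F g))\<^sup>2 \<le> (1 + \<delta> / 4) * (norm g)\<^sup>2"
      using N(2)[OF that] unfolding abs_le_iff by (simp_all add: algebra_simps)
    have "(1 + \<delta> / 4) * (norm g)\<^sup>2 \<le> ((1 + \<delta> / 8) * norm g)\<^sup>2"
      unfolding power_mult_distrib by (intro mult_right_mono) (auto simp: power2_eq_square field_simps)
    with b(2) show "norm (F g) \<le> (1 + \<delta> / 8) * norm g"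
      using \<delta> by (intro power2_le_imp_le[of "norm (F g)"]) (linarith, simp)
    have "(1 - \<delta> / 4)\<^sup>2 \<le> 1 - \<delta> / 4"
      using \<delta> by (simp add: power2_eq_square mult_left_le)
    then have "((1 - \<delta> / 4) * norm g)\<^sup>2 \<le> (1 - \<delta> / 4) * (norm g)\<^sup>2"
      unfolding power_mult_distrib by (intro mult_right_mono) auto
    from this b(1) show "(1 - \<delta> / 4) * norm g \<le> norm (F g)"
      by (rule power2_le_imp_le[OF order_trans]) simp
  qed
  \<comment> \<open>The ball, unlike the sphere, is nonempty even if \<open>W\<close> is the zero
    space.\<close>
  define S where "S = W \<inter> cball 0 1"
  have "compact S" unfolding S_def
    using closed_subspace[OF W] by (intro closed_Int_compact) auto
  moreover have "S \<noteq> {}" using subspace_0[OF W] by (auto simp: S_def)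
  moreover have "continuous_on S (\<lambda>v. norm (F v))"
    using F by (intro continuous_on_norm linear_continuous_on) (simp add: linear_linear)
  ultimately obtain v where v: "v \<in> S" "\<And>y. y \<in> S \<Longrightarrow> norm (F y) \<le> norm (F v)"
    using continuous_attains_sup by metis
  define L where "L = norm (F v)"
  have Fr: "norm (F r) \<le> L * norm r" if "r \<in> W" for r
  proof (cases "r = 0")
    case False
    have "(1 / norm r) *\<^sub>R r \<in> S"
      using that W False by (simp add: S_def subspace_scale)
    from v(2)[OF this] have "norm (F r) / norm r \<le> L" by (simp add: scale L_def)
    with False show ?thesis by (simp add: divide_le_eq)
  qed (simp add: linear_0[OF F])
  have approx: "\<exists>g\<in>N. norm g \<le> 1 \<and> norm (y - g) \<le> \<delta> / 10 \<and> norm (F (y - g)) \<le> L * (\<delta> / 10)"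
    if y: "y \<in> S" for y
  proof -
    obtain g where g: "g \<in> N" "norm g \<le> 1" "norm (y - g) \<le> \<delta> / 10"
      using net[of y] y unfolding S_def by auto
    have "norm (F (y - g)) \<le> L * norm (y - g)"
      using g y N W by (intro Fr subspace_diff) (auto simp: S_def)
    also have "\<dots> \<le> L * (\<delta> / 10)" using g by (intro mult_left_mono) (auto simp: L_def)
    finally show ?thesis using g by blast
  qed
  \<comment> \<open>Since \<open>\<delta> < 1\<close>, the net gives
    \<open>L \<le> 9 / 8 + L / 10\<close>, that is \<open>L \<le> 5 / 4\<close>.\<close>
  have L: "L \<le> 5 / 4"
  proof -
    obtain g where g: "g \<in> N" "norm g \<le> 1" "norm (F (v - g)) \<le> L * (\<delta> / 10)"
      using approx v by blast
    have "L \<le> norm (F g) + norm (F (v - g))"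
      using norm_triangle_ineq[of "F g" "F (v - g)"] by (simp add: L_def linear_diff[OF F])
    also have "norm (F g) \<le> (1 + \<delta> / 8) * 1"
      using g(2) \<delta> by (intro order_trans[OF Fg(1)[OF g(1)]] mult_left_mono) auto
    also have "norm (F (v - g)) \<le> L * (1 / 10)"
      using \<delta> by (intro order_trans[OF g(3)] mult_left_mono) (auto simp: L_def)
    finally show ?thesis using \<delta> by simp
  qed
  show "norm (F u) \<le> 5 / 4 * norm u"
    using Fr[OF u] mult_right_mono[OF L, of "norm u"] by simp
  show "(1 - 19 / 40 * \<delta>) * norm u \<le> norm (F u)"
  proof (cases "u = 0")
    case False
    let ?y = "(1 / norm u) *\<^sub>R u"
    have y: "?y \<in> S" "norm ?y = 1" using u W False by (auto simp: S_def subspace_scale)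
    obtain g where g: "g \<in> N" "norm (?y - g) \<le> \<delta> / 10" "norm (F (?y - g)) \<le> L * (\<delta> / 10)"
      using approx y by blast
    have "1 - \<delta> / 10 \<le> norm g"
      using g(2) y(2) norm_triangle_ineq[of g "?y - g"] by simp
    then have "(1 - \<delta> / 4) * (1 - \<delta> / 10) \<le> (1 - \<delta> / 4) * norm g"
      using \<delta> by (intro mult_left_mono) auto
    also have "\<dots> \<le> norm (F g)" by (rule Fg(2)[OF g(1)])
    also have "\<dots> \<le> norm (F ?y) + norm (F (?y - g))"
      using norm_triangle_ineq4[of "F ?y" "F (?y - g)"] by (simp add: linear_diff[OF F])
    also have "norm (F (?y - g)) \<le> 5 / 4 * (\<delta> / 10)"
      using g(3) mult_right_mono[OF L, of "\<delta> / 10"] \<delta> by linarith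
    finally have "(1 - \<delta> / 4) * (1 - \<delta> / 10) - \<delta> / 8 \<le> norm (F ?y)" by simp
    \<comment> \<open>The linear losses are \<open>1 / 4 + 1 / 10 + 1 / 8 = 19 / 40\<close>; the
      product term \<open>\<delta>\<^sup>2 / 40\<close> is positive.\<close>
    moreover have "1 - 19 / 40 * \<delta> \<le> (1 - \<delta> / 4) * (1 - \<delta> / 10) - \<delta> / 8"
      by (simp add: algebra_simps)
    moreover have "norm (F ?y) = norm (F u) / norm u" by (simp add: scale)
    ultimately have "1 - 19 / 40 * \<delta> \<le> norm (F u) / norm u" by linarith
    with False show ?thesis by (simp add: le_divide_eq)
  qed simp
qed

section \<open>From sparse vectors to the cone\<close>

text \<open>Second moment equals squared mean plus variance: the last two terms form the variance of
  \<open>x\<close>, which the shift by \<open>a\<close> leaves unchanged.\<close>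

lemma weighted_sum_norm_square:
  fixes x :: "'i \<Rightarrow> 'b :: real_inner"
  assumes "(\<Sum>i\<in>I. p i) = 1"
  shows "(\<Sum>i\<in>I. p i * (norm (a + x i))\<^sup>2)
    = (norm (a + (\<Sum>i\<in>I. p i *\<^sub>R x i)))\<^sup>2 + (\<Sum>i\<in>I. p i * (norm (x i))\<^sup>2) - (norm (\<Sum>i\<in>I. p i *\<^sub>R x i))\<^sup>2"
proof -
  have "(\<Sum>i\<in>I. p i * (norm (a + x i))\<^sup>2)
      = (\<Sum>i\<in>I. p i * (norm a)\<^sup>2 + 2 * (a \<bullet> (p i *\<^sub>R x i)) + p i * (norm (x i))\<^sup>2)"
    by (intro sum.cong) (auto simp: power2_norm_eq_inner inner_add inner_commute algebra_simps)
  also have "\<dots> = (norm a)\<^sup>2 + 2 * (a \<bullet> (\<Sum>i\<in>I. p i *\<^sub>R x i)) + (\<Sum>i\<in>I. p i * (norm (x i))\<^sup>2)"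
    using assms by (simp add: sum.distrib inner_sum_right sum_distrib_left sum_distrib_right[symmetric])
  also have "\<dots> = (norm (a + (\<Sum>i\<in>I. p i *\<^sub>R x i)))\<^sup>2 + (\<Sum>i\<in>I. p i * (norm (x i))\<^sup>2) - (norm (\<Sum>i\<in>I. p i *\<^sub>R x i))\<^sup>2"
    by (simp add: power2_norm_eq_inner inner_add inner_commute)
  finally show ?thesis .
qed

text \<open>Maurey's empirical method: \<open>l\<close> independent random atoms with mean \<open>\<mu>\<close> are added to \<open>w\<close> one at
  a time, so that every intermediate vector stays sparse.  Averaging over an atom costs the second
  moment of \<open>F\<close> on the left of the inequality and, by convexity, nothing on the side of \<open>G\<close>.\<close>
lemma sparse_lower_bound_empirical:
  fixes F :: "real ^ 'p \<Rightarrow> 'b :: real_inner" and G :: "real ^ 'p \<Rightarrow> 'c :: real_inner"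
    and c :: "'p \<Rightarrow> real"
  assumes F: "linear F" and G: "linear G" and \<kappa>: "0 \<le> \<kappa>"
    and sparse: "\<And>v. card {i. v $ i \<noteq> 0} \<le> s \<Longrightarrow> \<kappa> * (norm (G v))\<^sup>2 \<le> (norm (F v))\<^sup>2"
    and p: "\<And>i. i \<in> I \<Longrightarrow> 0 \<le> p i" "(\<Sum>i\<in>I. p i) = 1"
    and \<mu>_def: "\<mu> = (\<Sum>i\<in>I. p i *\<^sub>R c i *\<^sub>R axis i 1)"
    and w: "card {i. w $ i \<noteq> 0} + l \<le> s"
  shows "\<kappa> * (norm (G (w + real l *\<^sub>R \<mu>)))\<^sup>2
    \<le> (norm (F (w + real l *\<^sub>R \<mu>)))\<^sup>2 + l * (\<Sum>i\<in>I. p i * (norm (F (c i *\<^sub>R axis i 1)))\<^sup>2)"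
  using w
proof (induction l arbitrary: w)
  case 0
  then show ?case using sparse by simp
next
  case (Suc l)
  let ?u = "\<lambda>i. c i *\<^sub>R axis i 1 :: real ^ 'p"
  let ?E = "\<Sum>i\<in>I. p i * (norm (F (?u i)))\<^sup>2"
  let ?w = "w + real l *\<^sub>R \<mu>"
  \<comment> \<open>This and the next two facts are stated for an arbitrary linear \<open>H\<close>
    because they serve both \<open>F\<close> and \<open>G\<close>.\<close>
  have sum_lin: "(\<Sum>i\<in>I. p i *\<^sub>R H (?u i)) = H \<mu>" if "linear H" for H :: "real ^ 'p \<Rightarrow> 'd :: real_inner"
    by (simp add: \<mu>_def linear_sum[OF that] linear_scale[OF that])
  have mean: "(\<Sum>i\<in>I. p i * (norm (H (w + ?u i + real l *\<^sub>R \<mu>)))\<^sup>2)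
      = (norm (H (w + real (Suc l) *\<^sub>R \<mu>)))\<^sup>2 + ((\<Sum>i\<in>I. p i * (norm (H (?u i)))\<^sup>2) - (norm (H \<mu>))\<^sup>2)"
    if "linear H" for H :: "real ^ 'p \<Rightarrow> 'd :: real_inner"
  proof -
    have "H (w + ?u i + real l *\<^sub>R \<mu>) = H ?w + H (?u i)" for i
      by (simp add: linear_add[OF that] add_ac)
    moreover have "H (w + real (Suc l) *\<^sub>R \<mu>) = H ?w + H \<mu>"
      by (simp add: linear_add[OF that] linear_scale[OF that] algebra_simps)
    ultimately show ?thesis
      using weighted_sum_norm_square[OF p(2), of "H ?w" "\<lambda>i. H (?u i)"] by (simp add: sum_lin[OF that])
  qed
  \<comment> \<open>The variance is nonnegative: the identity is used with the shift
    \<open>- H \<mu>\<close>, which centres the vector.\<close>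
  have var: "(norm (H \<mu>))\<^sup>2 \<le> (\<Sum>i\<in>I. p i * (norm (H (?u i)))\<^sup>2)"
    if "linear H" for H :: "real ^ 'p \<Rightarrow> 'd :: real_inner"
  proof -
    have "0 \<le> (\<Sum>i\<in>I. p i * (norm (- H \<mu> + H (?u i)))\<^sup>2)"
      using p(1) by (intro sum_nonneg) auto
    then show ?thesis
      using weighted_sum_norm_square[OF p(2), of "- H \<mu>" "\<lambda>i. H (?u i)"] by (simp add: sum_lin[OF that])
  qed
  have step: "\<kappa> * (norm (G (w + ?u i + real l *\<^sub>R \<mu>)))\<^sup>2
      \<le> (norm (F (w + ?u i + real l *\<^sub>R \<mu>)))\<^sup>2 + l * ?E" for i
  proof (rule Suc.IH)
    \<comment> \<open>An atom adds at most one coordinate to the support, paid for by the decrease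
      from \<open>Suc l\<close> to \<open>l\<close>.\<close>
    have "{j. (w + ?u i) $ j \<noteq> 0} \<subseteq> insert i {j. w $ j \<noteq> 0}"
      by (auto simp: axis_def)
    then have "card {j. (w + ?u i) $ j \<noteq> 0} \<le> card (insert i {j. w $ j \<noteq> 0})"
      by (intro card_mono) auto
    also have "\<dots> \<le> Suc (card {j. w $ j \<noteq> 0})"
      by (simp add: card_insert_if)
    finally show "card {j. (w + ?u i) $ j \<noteq> 0} + l \<le> s" using Suc.prems by simp
  qed
  \<comment> \<open>On the side of \<open>G\<close> the nonnegative variance is added in order to
    pass to the average.\<close>
  have "\<kappa> * (norm (G (w + real (Suc l) *\<^sub>R \<mu>)))\<^sup>2
      \<le> \<kappa> * (\<Sum>i\<in>I. p i * (norm (G (w + ?u i + real l *\<^sub>R \<mu>)))\<^sup>2)"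
    using mean[OF G] var[OF G] \<kappa> by (intro mult_left_mono) auto
  also have "\<dots> = (\<Sum>i\<in>I. p i * (\<kappa> * (norm (G (w + ?u i + real l *\<^sub>R \<mu>)))\<^sup>2))"
    by (simp add: sum_distrib_left mult_ac)
  also have "\<dots> \<le> (\<Sum>i\<in>I. p i * ((norm (F (w + ?u i + real l *\<^sub>R \<mu>)))\<^sup>2 + l * ?E))"
    using p(1) step by (intro sum_mono mult_left_mono) auto
  also have "\<dots> = (\<Sum>i\<in>I. p i * (norm (F (w + ?u i + real l *\<^sub>R \<mu>)))\<^sup>2) + l * ?E"
    using p(2) by (simp only: distrib_left sum.distrib sum_distrib_right[symmetric] mult_1)
  \<comment> \<open>On the side of \<open>F\<close> the variance is at most the second moment, which
    supplies one further copy of \<open>?E\<close>.\<close>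
  also have "\<dots> \<le> (norm (F (w + real (Suc l) *\<^sub>R \<mu>)))\<^sup>2 + Suc l * ?E"
    unfolding mean[OF F] of_nat_Suc distrib_right by simp
  finally show ?case .
qed

text \<open>Coordinates outside \<open>J\<close> are drawn with probability proportional to
  \<open>\<bar>x $ i\<bar>\<close>, and \<open>l\<close> atoms sum in mean to the part of
  \<open>x\<close> outside \<open>J\<close>. Each atom has second moment at most
  \<open>(c / l)\<^sup>2 * \<beta>\<close>, whence the loss
  \<open>c\<^sup>2 * \<beta> / l\<close>.\<close>

lemma sparse_lower_bound_extends:
  fixes F :: "real ^ 'p \<Rightarrow> 'b :: real_inner" and G :: "real ^ 'p \<Rightarrow> 'c :: real_inner"
  assumes F: "linear F" and G: "linear G" and \<kappa>: "0 \<le> \<kappa>"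
    and sparse: "\<And>v. card {i. v $ i \<noteq> 0} \<le> s \<Longrightarrow> \<kappa> * (norm (G v))\<^sup>2 \<le> (norm (F v))\<^sup>2"
    and \<beta>: "\<And>j. (norm (F (axis j 1)))\<^sup>2 \<le> \<beta>"
    and J: "card J + l \<le> s" and l: "0 < l"
  shows "\<kappa> * (norm (G x))\<^sup>2 \<le> (norm (F x))\<^sup>2 + (\<Sum>i\<in>-J. \<bar>x $ i\<bar>)\<^sup>2 * \<beta> / l"
proof (cases "(\<Sum>i\<in>-J. \<bar>x $ i\<bar>) = 0")
  \<comment> \<open>The sampling probabilities would divide by 0 here, but \<open>x\<close> is
    supported in \<open>J\<close> and hence already sparse.\<close>
  case True
  then have "{i. x $ i \<noteq> 0} \<subseteq> J" by (auto simp: sum_nonneg_eq_0_iff)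
  then have "card {i. x $ i \<noteq> 0} \<le> s" using J by (meson card_mono finite le_add1 order.trans)
  from sparse[OF this] True show ?thesis by simp
next
  case False
  define c where "c = (\<Sum>i\<in>-J. \<bar>x $ i\<bar>)"
  have "0 \<le> c" unfolding c_def by (intro sum_nonneg) simp
  then have c: "0 < c" using False unfolding c_def by linarith
  define p where "p i = \<bar>x $ i\<bar> / c" for i
  define w where "w = (\<chi> i. if i \<in> J then x $ i else 0)"
  \<comment> \<open>All atoms have the same length \<open>c / l\<close>; the sign and the factor
    \<open>c\<close> turn the probability \<open>p i\<close> back into \<open>x $ i\<close>, up to
    \<open>l\<close>.\<close>
  define a where "a i = c * sgn (x $ i) / l" for i
  define \<mu> where "\<mu> = (\<Sum>i\<in>-J. p i *\<^sub>R a i *\<^sub>R axis i 1 :: real ^ 'p)"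
  have p: "\<And>i. i \<in> - J \<Longrightarrow> 0 \<le> p i" "(\<Sum>i\<in>-J. p i) = 1"
    using c by (simp_all add: p_def sum_divide_distrib[symmetric] c_def)
  have "l * (p i * a i) = x $ i" for i
    using c l by (simp add: p_def a_def abs_mult_sgn flip: mult_sgn_abs)
  then have x: "w + real l *\<^sub>R \<mu> = x"
    by (simp add: vec_eq_iff w_def \<mu>_def axis_def sum_distrib_left if_distrib cong: if_cong)
  have "{i. w $ i \<noteq> 0} \<subseteq> J" by (auto simp: w_def split: if_splits)
  then have "card {i. w $ i \<noteq> 0} \<le> card J" by (intro card_mono) auto
  then have "card {i. w $ i \<noteq> 0} + l \<le> s" using J by simp
  from sparse_lower_bound_empirical[OF F G \<kappa> sparse p \<mu>_def this]
  have "\<kappa> * (norm (G x))\<^sup>2 \<le> (norm (F x))\<^sup>2 + l * (\<Sum>i\<in>-J. p i * (norm (F (a i *\<^sub>R axis i 1)))\<^sup>2)"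
    by (simp add: x)
  also have "(\<Sum>i\<in>-J. p i * (norm (F (a i *\<^sub>R axis i 1)))\<^sup>2) \<le> (\<Sum>i\<in>-J. p i * ((c / l)\<^sup>2 * \<beta>))"
  proof (intro sum_mono mult_left_mono p(1))
    fix i
    have "(a i)\<^sup>2 \<le> (c / l)\<^sup>2" using c by (auto simp: a_def sgn_if)
    then have "(a i)\<^sup>2 * (norm (F (axis i 1)))\<^sup>2 \<le> (c / l)\<^sup>2 * \<beta>"
      using \<beta> by (intro mult_mono) auto
    then show "(norm (F (a i *\<^sub>R axis i 1)))\<^sup>2 \<le> (c / l)\<^sup>2 * \<beta>"
      by (simp add: linear_scale[OF F] power_mult_distrib)
  qed
  also have "\<dots> = (c / l)\<^sup>2 * \<beta>" using p(2) by (simp flip: sum_distrib_right)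
  also have "l * ((c / l)\<^sup>2 * \<beta>) = c\<^sup>2 * \<beta> / l" using l by (simp add: power2_eq_square)
  finally show ?thesis using l by (simp add: c_def)
qed

section \<open>The restricted eigenvalue infimum: bounds, monotonicity, measurability\<close>

lemma axis_in_RE_cone: "0 \<le> k \<Longrightarrow> axis i c \<in> RE_cone {i} k"
  by (simp add: RE_cone_def axis_def)

lemma RE_cone_L2_pos:
  assumes "v \<noteq> 0" "v \<in> RE_cone J k"
  shows "0 < L2_set (\<lambda>i. v $ i) J"
proof -
  have "L2_set (\<lambda>i. v $ i) J \<noteq> 0"
  proof
    assume "L2_set (\<lambda>i. v $ i) J = 0"
    then have J: "v $ i = 0" if "i \<in> J" for i using that by (simp add: L2_set_eq_0_iff)
    then have "(\<Sum>i\<in>-J. \<bar>v $ i\<bar>) \<le> 0" using assms(2) by (simp add: RE_cone_def)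
    then have "(\<Sum>i\<in>-J. \<bar>v $ i\<bar>) = 0" by (intro antisym sum_nonneg) auto
    then have "v $ i = 0" for i using J by (cases "i \<in> J") (auto simp: sum_nonneg_eq_0_iff)
    with assms(1) show False by (simp add: vec_eq_iff)
  qed
  then show ?thesis by (simp add: order_less_le L2_set_nonneg)
qed

text \<open>The product form also covers a vanishing restriction to \<open>J\<close>, where the
  quotient says nothing; otherwise the infimum is a lower bound because 0 bounds all quotients from
  below.\<close>

lemma RE_min_le:
  assumes "card J \<le> s" "v \<in> RE_cone J k"
  shows "RE_min s k A * L2_set (\<lambda>i. v $ i) J \<le> norm (A *v v)"
proof (cases "L2_set (\<lambda>i. v $ i) J = 0")
  case False
  then have "0 < L2_set (\<lambda>i. v $ i) J" by (simp add: order_less_le L2_set_nonneg)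
  moreover have "RE_min s k A \<le> norm (A *v v) / L2_set (\<lambda>i. v $ i) J"
    unfolding RE_min_def
  proof (rule cInf_lower)
    have "v \<noteq> 0" using False by (auto simp: L2_set_def)
    then show "norm (A *v v) / L2_set (\<lambda>i. v $ i) J
      \<in> {norm (A *v v) / L2_set (\<lambda>i. v $ i) J | J v. card J \<le> s \<and> v \<noteq> 0 \<and> v \<in> RE_cone J k}"
      using assms by blast
  qed (auto intro!: bdd_belowI[of _ 0] L2_set_nonneg)
  ultimately show ?thesis by (simp add: le_divide_eq)
qed simp

text \<open>A real infimum is meaningful only over a nonempty set; a coordinate vector with its
  singleton \<open>J\<close> provides a member, which uses \<open>0 < s\<close>.\<close>

lemma RE_min_greatest:
  fixes A :: "real ^ 'p ^ 'q"
  assumes "0 < s" "0 \<le> k"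
    and "\<And>J v. card J \<le> s \<Longrightarrow> v \<noteq> 0 \<Longrightarrow> v \<in> RE_cone J k \<Longrightarrow> c \<le> norm (A *v v) / L2_set (\<lambda>i. v $ i) J"
  shows "c \<le> RE_min s k A"
  unfolding RE_min_def
proof (rule cInf_greatest)
  obtain i :: 'p where True by simp
  have "axis i (1 :: real) \<noteq> 0" by (simp add: axis_eq_0_iff)
  with axis_in_RE_cone[OF assms(2), of i 1] assms(1)
  show "{norm (A *v v) / L2_set (\<lambda>i. v $ i) J | J v. card J \<le> s \<and> v \<noteq> 0 \<and> v \<in> RE_cone J k} \<noteq> {}"
    by (auto intro!: exI[of _ "{i}"] exI[of _ "axis i 1"])
qed (use assms(3) in auto)

text \<open>A larger \<open>k\<close> enlarges the cones. This passes from the condition with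
  \<open>3 * k\<^sub>0\<close> to the one with \<open>k\<^sub>0\<close>.\<close>

lemma RE_min_antimono:
  fixes A :: "real ^ 'p ^ 'q"
  assumes "0 < s" "0 \<le> k" "k \<le> k'"
  shows "RE_min s k' A \<le> RE_min s k A"
proof (rule RE_min_greatest[OF assms(1,2)])
  fix J and v :: "real ^ 'p" assume *: "card J \<le> s" "v \<noteq> 0" "v \<in> RE_cone J k"
  have "k * (\<Sum>i\<in>J. \<bar>v $ i\<bar>) \<le> k' * (\<Sum>i\<in>J. \<bar>v $ i\<bar>)"
    using assms by (intro mult_right_mono sum_nonneg) auto
  with * have "v \<in> RE_cone J k'" by (auto simp: RE_cone_def)
  moreover have "0 < L2_set (\<lambda>i. v $ i) J" by (rule RE_cone_L2_pos[OF *(2,3)])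
  ultimately show "RE_min s k' A \<le> norm (A *v v) / L2_set (\<lambda>i. v $ i) J"
    using RE_min_le[OF *(1), of v k' A]
    by (simp add: le_divide_eq)
qed

lemma RE_min_scale_le:
  fixes A :: "real ^ 'p ^ 'q" and B :: "real ^ 'p ^ 'n"
  assumes "0 < s" "0 \<le> k" "0 \<le> c"
    and "\<And>J v. card J \<le> s \<Longrightarrow> v \<in> RE_cone J k \<Longrightarrow> c * norm (A *v v) \<le> norm (B *v v)"
  shows "c * RE_min s k A \<le> RE_min s k B"
proof (rule RE_min_greatest[OF assms(1,2)])
  fix J and v :: "real ^ 'p" assume *: "card J \<le> s" "v \<noteq> 0" "v \<in> RE_cone J k"
  have "0 < L2_set (\<lambda>i. v $ i) J" by (rule RE_cone_L2_pos[OF *(2,3)])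
  moreover have "c * RE_min s k A * L2_set (\<lambda>i. v $ i) J \<le> norm (B *v v)"
    using mult_left_mono[OF RE_min_le[OF *(1,3)] assms(3), of A] assms(4)[OF *(1,3)] by simp
  ultimately show "c * RE_min s k A \<le> norm (B *v v) / L2_set (\<lambda>i. v $ i) J"
    by (simp add: le_divide_eq)
qed

text \<open>As an infimum of continuous functions of the matrix, \<open>RE_min\<close> is upper semicontinuous.\<close>
lemma borel_measurable_RE_min:
  fixes s :: nat
  assumes "0 < s" "0 \<le> k"
  shows "(RE_min s k :: real ^ 'p ^ 'q \<Rightarrow> real) \<in> borel_measurable borel"
proof (rule borel_measurableI_less)
  fix c
  let ?P = "\<lambda>J v. card J \<le> s \<and> v \<noteq> 0 \<and> v \<in> RE_cone J k"
  \<comment> \<open>An infimum lies below \<open>c\<close> exactly if some member does, so the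
    sublevel set is a union of sets that are open by continuity.\<close>
  have eq: "{A :: real ^ 'p ^ 'q. RE_min s k A < c}
      = (\<Union>J. \<Union>v\<in>{v. ?P J v}. {A. norm (A *v v) / L2_set (\<lambda>i. v $ i) J < c})"
  proof (intro set_eqI iffI)
    fix A :: "real ^ 'p ^ 'q" assume "A \<in> {A. RE_min s k A < c}"
    then have "\<not> c \<le> RE_min s k A" by simp
    then show "A \<in> (\<Union>J. \<Union>v\<in>{v. ?P J v}. {A. norm (A *v v) / L2_set (\<lambda>i. v $ i) J < c})"
      using RE_min_greatest[OF assms, of c A] by (simp add: not_le) (meson not_le)
  next
    fix A :: "real ^ 'p ^ 'q"
    assume "A \<in> (\<Union>J. \<Union>v\<in>{v. ?P J v}. {A. norm (A *v v) / L2_set (\<lambda>i. v $ i) J < c})"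
    then obtain J v where Jv: "?P J v" "norm (A *v v) / L2_set (\<lambda>i. v $ i) J < c" by auto
    have "RE_min s k A \<le> norm (A *v v) / L2_set (\<lambda>i. v $ i) J"
      unfolding RE_min_def using Jv(1)
      by (intro cInf_lower) (auto intro!: bdd_belowI[of _ 0] L2_set_nonneg)
    with Jv(2) show "A \<in> {A. RE_min s k A < c}" by simp
  qed
  have "continuous_on UNIV (\<lambda>A :: real ^ 'p ^ 'q. norm (A *v v) / L2_set (\<lambda>i. v $ i) J)" for v J
    by (cases "L2_set (\<lambda>i. v $ i) J = 0")
      (auto intro!: continuous_intros simp: matrix_vector_mult_def)
  then have "open {A :: real ^ 'p ^ 'q. norm (A *v v) / L2_set (\<lambda>i. v $ i) J < c}" for v J
    by (intro open_Collect_less) auto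
  then have "open {A :: real ^ 'p ^ 'q. RE_min s k A < c}" unfolding eq by blast
  then show "{A \<in> space borel. RE_min s k A < c} \<in> sets (borel :: (real ^ 'p ^ 'q) measure)" by simp
qed

text \<open>The loss in the empirical method is measured against \<open>norm (A *v x)\<close>: the
  cone condition and Cauchy-Schwarz bound the l1-norm outside \<open>J\<close> by
  \<open>k\<^sub>0 * sqrt s\<^sub>0\<close> times the l2-norm on \<open>J\<close>, and the condition
  on \<open>A\<close> bounds the latter.\<close>

lemma RE_reduction:
  fixes A :: "real ^ 'p ^ 'q" and B :: "real ^ 'p ^ 'n"
  assumes \<delta>: "0 < \<delta>" "\<delta> < 1" and k: "0 < k\<^sub>0" and RE: "RE s\<^sub>0 (3 * k\<^sub>0) A"
    and d: "d = real s\<^sub>0 + real s\<^sub>0 * (MAX j. (norm (A *v axis j 1))\<^sup>2)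
             * (16 * (RE_K s\<^sub>0 (3 * k\<^sub>0) A)\<^sup>2 * (3 * k\<^sub>0)\<^sup>2 * (3 * k\<^sub>0 + 1) / \<delta>\<^sup>2)"
    and sparse: "\<And>v. card {i. v $ i \<noteq> 0} \<le> nat \<lceil>min d (real CARD('p))\<rceil>
      \<Longrightarrow> (1 - 19 / 40 * \<delta>) * norm (A *v v) \<le> norm (B *v v)"
    and column: "\<And>j. norm (B *v axis j 1) \<le> 5 / 4 * norm (A *v axis j 1)"
    and x: "card J \<le> s\<^sub>0" "x \<in> RE_cone J k\<^sub>0"
  shows "(1 - \<delta>) * norm (A *v x) \<le> norm (B *v x)"
proof (cases "real CARD('p) \<le> d")
  case True
  \<comment> \<open>If \<open>d\<close> reaches the dimension, every vector counts as
    sparse.\<close>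
  have "card {i. x $ i \<noteq> 0} \<le> CARD('p)" by (intro card_mono) auto
  then have "(1 - 19 / 40 * \<delta>) * norm (A *v x) \<le> norm (B *v x)"
    using True by (intro sparse) (simp add: min_def)
  moreover have "(1 - \<delta>) * norm (A *v x) \<le> (1 - 19 / 40 * \<delta>) * norm (A *v x)"
    using \<delta> by (intro mult_right_mono) auto
  ultimately show ?thesis by linarith
next
  case False
  define \<rho> where "\<rho> = RE_min s\<^sub>0 (3 * k\<^sub>0) A"
  define S where "S = (MAX j. (norm (A *v axis j 1))\<^sup>2)"
  \<comment> \<open>The number of atoms: the sparsity level less the room kept for the coordinates
    in \<open>J\<close>.\<close>
  define l where "l = nat \<lceil>d\<rceil> - s\<^sub>0"
  define c where "c = (\<Sum>i\<in>-J. \<bar>x $ i\<bar>)"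
  have \<rho>: "0 < \<rho>" and s0: "0 < s\<^sub>0" using RE by (auto simp: RE_def \<rho>_def)
  have S: "(norm (A *v axis j 1))\<^sup>2 \<le> S" for j
    unfolding S_def by (rule Max_ge) auto
  \<comment> \<open>No column of \<open>A\<close> vanishes, because each coordinate vector lies in
    the cone of its singleton.\<close>
  have S0: "0 < S"
  proof -
    obtain j :: 'p where True by simp
    have "\<rho> * L2_set (\<lambda>i. axis j 1 $ i) {j} \<le> norm (A *v axis j 1)"
      unfolding \<rho>_def using s0 k by (intro RE_min_le axis_in_RE_cone) auto
    moreover have "L2_set (\<lambda>i. axis j 1 $ i) {j} = (1 :: real)" by (simp add: axis_def)
    ultimately have "0 < norm (A *v axis j 1)"
      using \<rho> by (metis mult.right_neutral order_less_le_trans)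
    then have "0 < (norm (A *v axis j 1))\<^sup>2" by simp
    with S[of j] show ?thesis by linarith
  qed
  \<comment> \<open>This is \<open>d - s\<^sub>0\<close>, with \<open>144 = 16 * 3\<^sup>2\<close>
    and \<open>1 / \<rho>\<close> in place of \<open>RE_K\<close>; rounding up gives
    \<open>D \<le> l\<close>.\<close>
  define D where "D = real s\<^sub>0 * S * (144 * k\<^sub>0\<^sup>2 * (3 * k\<^sub>0 + 1) / (\<rho>\<^sup>2 * \<delta>\<^sup>2))"
  have D: "0 < D" unfolding D_def using s0 S0 k \<rho> \<delta> by simp
  have "d = real s\<^sub>0 + D"
    unfolding d D_def RE_K_def S_def[symmetric] \<rho>_def[symmetric] by (simp add: power_divide power_mult_distrib)
  then have l: "D \<le> real l" unfolding l_def using D by linarith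
  have l0: "0 < l" using l D by linarith
  have lm: "card J + l \<le> nat \<lceil>min d (real CARD('p))\<rceil>"
    using False x(1) \<open>d = real s\<^sub>0 + D\<close> D unfolding l_def min_def by simp linarith
  have "(1 - 19 / 40 * \<delta>)\<^sup>2 * (norm (A *v x))\<^sup>2 \<le> (norm (B *v x))\<^sup>2 + c\<^sup>2 * ((5 / 4)\<^sup>2 * S) / l"
    unfolding c_def
  proof (rule sparse_lower_bound_extends[OF _ _ _ _ _ lm l0])
    fix v :: "real ^ 'p" assume "card {i. v $ i \<noteq> 0} \<le> nat \<lceil>min d (real CARD('p))\<rceil>"
    from power_mono[OF sparse[OF this], of 2] \<delta>
    show "(1 - 19 / 40 * \<delta>)\<^sup>2 * (norm (A *v v))\<^sup>2 \<le> (norm (B *v v))\<^sup>2"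
      by (simp add: power_mult_distrib)
  next
    fix j
    have "(norm (B *v axis j 1))\<^sup>2 \<le> (5 / 4 * norm (A *v axis j 1))\<^sup>2"
      using column by (intro power_mono) auto
    with S[of j] show "(norm (B *v axis j 1))\<^sup>2 \<le> (5 / 4)\<^sup>2 * S" by (simp add: power2_eq_square)
  qed auto
  also have "c\<^sup>2 * ((5 / 4)\<^sup>2 * S) / l \<le> \<delta>\<^sup>2 / 50 * (norm (A *v x))\<^sup>2"
  proof -
    have "(\<Sum>i\<in>J. \<bar>x $ i\<bar> * \<bar>1\<bar>) \<le> L2_set (\<lambda>i. x $ i) J * L2_set (\<lambda>_. 1) J"
      by (rule L2_set_mult_ineq)
    also have "\<dots> \<le> L2_set (\<lambda>i. x $ i) J * sqrt s\<^sub>0"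
      using x(1) by (intro mult_left_mono) (auto simp: L2_set_def sum_nonneg)
    finally have l1: "(\<Sum>i\<in>J. \<bar>x $ i\<bar>) \<le> L2_set (\<lambda>i. x $ i) J * sqrt s\<^sub>0" by simp
    have "c \<le> k\<^sub>0 * (\<Sum>i\<in>J. \<bar>x $ i\<bar>)" using x(2) by (simp add: c_def RE_cone_def)
    also have "\<dots> \<le> k\<^sub>0 * (L2_set (\<lambda>i. x $ i) J * sqrt s\<^sub>0)"
      using l1 k by (intro mult_left_mono) auto
    finally have cc: "c \<le> k\<^sub>0 * (L2_set (\<lambda>i. x $ i) J * sqrt s\<^sub>0)" .
    have "x \<in> RE_cone J (3 * k\<^sub>0)"
    proof -
      have "0 \<le> k\<^sub>0 * (\<Sum>i\<in>J. \<bar>x $ i\<bar>)" using k by (intro mult_nonneg_nonneg sum_nonneg) auto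
      with x(2) show ?thesis by (simp add: RE_cone_def)
    qed
    then have "\<rho> * L2_set (\<lambda>i. x $ i) J \<le> norm (A *v x)"
      unfolding \<rho>_def using x(1) by (intro RE_min_le)
    then have "(\<rho> * L2_set (\<lambda>i. x $ i) J) * (k\<^sub>0 * sqrt s\<^sub>0) \<le> norm (A *v x) * (k\<^sub>0 * sqrt s\<^sub>0)"
      using k by (intro mult_right_mono) auto
    moreover have "\<rho> * c \<le> \<rho> * (k\<^sub>0 * (L2_set (\<lambda>i. x $ i) J * sqrt s\<^sub>0))"
      using cc \<rho> by (intro mult_left_mono) auto
    ultimately have "\<rho> * c \<le> norm (A *v x) * (k\<^sub>0 * sqrt s\<^sub>0)" by (simp add: mult_ac)
    moreover have "0 \<le> c" unfolding c_def by (intro sum_nonneg) auto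
    ultimately have "(\<rho> * c)\<^sup>2 \<le> (norm (A *v x) * (k\<^sub>0 * sqrt s\<^sub>0))\<^sup>2"
      using \<rho> by (intro power_mono) auto
    then have c2: "\<rho>\<^sup>2 * c\<^sup>2 \<le> (norm (A *v x))\<^sup>2 * (k\<^sub>0\<^sup>2 * s\<^sub>0)"
      by (simp add: power_mult_distrib)
    \<comment> \<open>The factor \<open>3 * k\<^sub>0 + 1\<close> is at least 1 and is
      dropped.\<close>
    have "real s\<^sub>0 * S * (144 * k\<^sub>0\<^sup>2) \<le> real s\<^sub>0 * S * (144 * k\<^sub>0\<^sup>2 * (3 * k\<^sub>0 + 1))"
      using k S0 by (intro mult_left_mono) (auto simp: algebra_simps)
    also have "\<dots> = D * (\<rho>\<^sup>2 * \<delta>\<^sup>2)" unfolding D_def using \<rho> \<delta> by simp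
    also have "\<dots> \<le> l * (\<rho>\<^sup>2 * \<delta>\<^sup>2)" using l by (intro mult_right_mono) auto
    finally have "144 * ((k\<^sub>0\<^sup>2 * s\<^sub>0) * S) \<le> l * (\<rho>\<^sup>2 * \<delta>\<^sup>2)" by (simp add: mult_ac)
    then have "(norm (A *v x))\<^sup>2 * (144 * ((k\<^sub>0\<^sup>2 * s\<^sub>0) * S)) \<le> (norm (A *v x))\<^sup>2 * (l * (\<rho>\<^sup>2 * \<delta>\<^sup>2))"
      by (intro mult_left_mono) auto
    moreover have "\<rho>\<^sup>2 * c\<^sup>2 * (144 * S) \<le> (norm (A *v x))\<^sup>2 * (k\<^sub>0\<^sup>2 * s\<^sub>0) * (144 * S)"
      using c2 S0 by (intro mult_right_mono) auto
    ultimately have "\<rho>\<^sup>2 * (c\<^sup>2 * (144 * S)) \<le> \<rho>\<^sup>2 * ((norm (A *v x))\<^sup>2 * (l * \<delta>\<^sup>2))"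
      by (simp add: mult_ac)
    then have "c\<^sup>2 * (144 * S) \<le> (norm (A *v x))\<^sup>2 * (l * \<delta>\<^sup>2)" using \<rho> by simp
    moreover have "0 \<le> (norm (A *v x))\<^sup>2 * (l * \<delta>\<^sup>2)" by simp
    \<comment> \<open>Numerically, \<open>(5 / 4)\<^sup>2 / 144 < 1 / 50\<close>.\<close>
    ultimately have "c\<^sup>2 * ((5 / 4)\<^sup>2 * S) \<le> \<delta>\<^sup>2 / 50 * (norm (A *v x))\<^sup>2 * l"
      by (simp add: power2_eq_square mult_ac)
    then show ?thesis using l0 by (simp add: divide_le_eq)
  qed
  finally have "((1 - 19 / 40 * \<delta>)\<^sup>2 - \<delta>\<^sup>2 / 50) * (norm (A *v x))\<^sup>2 \<le> (norm (B *v x))\<^sup>2"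
    by (simp add: left_diff_distrib)
  moreover have "(1 - \<delta>)\<^sup>2 \<le> (1 - 19 / 40 * \<delta>)\<^sup>2 - \<delta>\<^sup>2 / 50"
  proof -
    have "(1 - 19 / 40 * \<delta>)\<^sup>2 - \<delta>\<^sup>2 / 50 - (1 - \<delta>)\<^sup>2 = \<delta> * (21 / 20 - 1271 / 1600 * \<delta>)"
      by (simp add: power2_eq_square field_simps)
    moreover have "0 \<le> \<delta> * (21 / 20 - 1271 / 1600 * \<delta>)" using \<delta> by (intro mult_nonneg_nonneg) auto
    ultimately show ?thesis by linarith
  qed
  then have "(1 - \<delta>)\<^sup>2 * (norm (A *v x))\<^sup>2 \<le> ((1 - 19 / 40 * \<delta>)\<^sup>2 - \<delta>\<^sup>2 / 50) * (norm (A *v x))\<^sup>2"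
    by (intro mult_right_mono) auto
  ultimately have "((1 - \<delta>) * norm (A *v x))\<^sup>2 \<le> (norm (B *v x))\<^sup>2"
    by (simp add: power_mult_distrib)
  then show ?thesis by (rule power2_le_imp_le) simp
qed

section \<open>The union bound\<close>

text \<open>A single term of the expansion of \<open>(1 + x) ^ n\<close> at \<open>x = k / n\<close>
  is at most \<open>exp k\<close>; this gives the usual bound of the binomial coefficient by the
  \<open>k\<close>-th power of \<open>exp 1 * n / k\<close>.\<close>

lemma binomial_mult_power_le_exp:
  fixes c :: real
  assumes k: "0 < k" and c: "0 < c"
  shows "real (n choose k) * c ^ k \<le> exp (k * ln (exp 1 * n * c / k))"
proof (cases "n = 0")
  case False
  define x where "x = real k / n"
  have x: "0 < x" using k False by (simp add: x_def)
  have nk: "exp 1 * n * c / k = exp 1 * c / x" by (simp add: x_def)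
  show ?thesis
  proof (cases "k \<le> n")
    case True
    have "real (n choose k) * x ^ k \<le> (\<Sum>j\<le>n. real (n choose j) * x ^ j)"
      using x True by (intro member_le_sum) auto
    also have "\<dots> = (1 + x) ^ n"
      using binomial_ring[of x 1 n] by (simp add: add.commute)
    also have "\<dots> \<le> exp x ^ n"
      using x by (intro power_mono exp_ge_add_one_self) auto
    also have "\<dots> = exp 1 ^ k"
      using False by (simp add: x_def flip: exp_of_nat_mult)
    finally have "real (n choose k) \<le> exp 1 ^ k / x ^ k" using x by (simp add: le_divide_eq)
    then have "real (n choose k) * c ^ k \<le> exp 1 ^ k / x ^ k * c ^ k"
      using c by (intro mult_right_mono) auto
    also have "\<dots> = (exp 1 * c / x) ^ k" by (simp add: power_mult_distrib power_divide)
    also have "\<dots> = exp (k * ln (exp 1 * c / x))"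
      using x c by (simp add: exp_of_nat_mult)
    finally show ?thesis by (simp only: nk)
  qed (simp add: binomial_eq_0)
qed (use k in \<open>simp add: binomial_eq_0\<close>)

lemma matrix_vector_sparse_in_span:
  fixes A :: "real ^ 'p ^ 'q"
  assumes "{i. v $ i \<noteq> 0} \<subseteq> J"
  shows "A *v v \<in> span ((\<lambda>j. A *v axis j 1) ` J)"
proof -
  have "A *v v = (\<Sum>j\<in>UNIV. v $ j *\<^sub>R (A *v axis j 1))"
    by (simp only: matrix_vector_mult_basis) (simp add: matrix_mult_sum scalar_mult_eq_scaleR)
  also have "\<dots> = (\<Sum>j\<in>J. v $ j *\<^sub>R (A *v axis j 1))"
    using assms by (intro sum.mono_neutral_right) auto
  also have "\<dots> \<in> span ((\<lambda>j. A *v axis j 1) ` J)"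
    by (intro span_sum span_scale span_base) auto
  finally show ?thesis .
qed

lemma norm_matrix_vector_square:
  fixes B :: "real ^ 'q ^ 'n"
  shows "(norm (B *v u))\<^sup>2 = (\<Sum>i\<in>UNIV. (row i B \<bullet> u)\<^sup>2)"
  unfolding power2_norm_eq_inner
  by (simp add: inner_vec_def matrix_vector_mult_def row_def power2_eq_square)

lemma borel_measurable_rows:
  fixes \<Psi> :: "'w \<Rightarrow> real ^ 'q ^ 'n"
  assumes "\<And>i. (\<lambda>\<omega>. row i (\<Psi> \<omega>)) \<in> borel_measurable M"
  shows "\<Psi> \<in> borel_measurable M"
proof (subst borel_measurable_euclidean_space, intro ballI)
  fix b :: "real ^ 'q ^ 'n" assume "b \<in> Basis"
  then obtain i e where "b = axis i e" by (auto simp: Basis_vec_def)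
  then have "(\<lambda>\<omega>. \<Psi> \<omega> \<bullet> b) = (\<lambda>\<omega>. row i (\<Psi> \<omega>) \<bullet> e)"
    by (simp add: inner_axis row_def)
  then show "(\<lambda>\<omega>. \<Psi> \<omega> \<bullet> b) \<in> borel_measurable M"
    using assms[of i] by simp
qed

lemma (in prob_space) psi2_matrix_almost_isometry_on_finite:
  fixes \<Psi> :: "'a \<Rightarrow> real ^ 'q ^ 'n" and \<epsilon> a :: real
  assumes ind: "indep_vars (\<lambda>_. borel) (\<lambda>i \<omega>. row i (\<Psi> \<omega>)) UNIV"
    and iso: "\<And>i. isotropic M (\<lambda>\<omega>. row i (\<Psi> \<omega>))"
    and psi2: "\<And>i. psi2_vector M \<alpha> (\<lambda>\<omega>. row i (\<Psi> \<omega>))"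
    and \<epsilon>: "0 \<le> \<epsilon>" "\<epsilon> \<le> 2" and a: "1 \<le> a" "\<alpha> < a" and N: "finite N"
  defines "E \<equiv> {\<omega> \<in> space M. \<forall>g\<in>N.
    \<bar>(norm ((1 / sqrt (real CARD('n))) *\<^sub>R (\<Psi> \<omega> *v g)))\<^sup>2 - (norm g)\<^sup>2\<bar> \<le> \<epsilon> * (norm g)\<^sup>2}"
  shows "E \<in> sets M"
    and "1 - 2 * card N * exp (- (CARD('n) * \<epsilon>\<^sup>2 / (4 * a ^ 4))) \<le> prob E"
proof -
  have [measurable]: "(\<lambda>\<omega>. row i (\<Psi> \<omega>)) \<in> borel_measurable M" for i
    using ind by (auto simp: indep_vars_def)
  let ?n = "real CARD('n)"
  let ?S = "\<lambda>g \<omega>. \<Sum>i\<in>UNIV. (row i (\<Psi> \<omega>) \<bullet> g)\<^sup>2"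
  define T where "T g = {\<omega> \<in> space M. \<epsilon> * ?n * (norm g)\<^sup>2 \<le> \<bar>?S g \<omega> - ?n * (norm g)\<^sup>2\<bar>}" for g
  have n: "0 < ?n" by simp
  have Sn: "\<bar>(norm ((1 / sqrt ?n) *\<^sub>R (\<Psi> \<omega> *v g)))\<^sup>2 - (norm g)\<^sup>2\<bar> = \<bar>?S g \<omega> - ?n * (norm g)\<^sup>2\<bar> / ?n" for g \<omega>
  proof -
    have "(norm ((1 / sqrt ?n) *\<^sub>R (\<Psi> \<omega> *v g)))\<^sup>2 - (norm g)\<^sup>2 = (?S g \<omega> - ?n * (norm g)\<^sup>2) / ?n"
      using n by (simp add: power_divide norm_matrix_vector_square diff_divide_distrib)
    then show ?thesis by simp
  qed
  have Eeq: "E = {\<omega> \<in> space M. \<forall>g\<in>N. \<bar>?S g \<omega> - ?n * (norm g)\<^sup>2\<bar> \<le> \<epsilon> * ?n * (norm g)\<^sup>2}"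
    unfolding E_def Sn using n by (simp add: divide_le_eq mult_ac)
  show E: "E \<in> sets M" unfolding Eeq using N by measurable
  have T: "T g \<in> sets M" for g unfolding T_def by measurable
  \<comment> \<open>The vector 0 satisfies the estimate trivially and is left out, since the tail
    bound requires a nonzero vector.\<close>
  have "space M - E \<subseteq> (\<Union>g\<in>N - {0}. T g)"
  proof
    fix \<omega> assume "\<omega> \<in> space M - E"
    then obtain g where g: "\<omega> \<in> space M" "g \<in> N" "\<epsilon> * ?n * (norm g)\<^sup>2 < \<bar>?S g \<omega> - ?n * (norm g)\<^sup>2\<bar>"
      by (auto simp: Eeq not_le)
    then have "g \<noteq> 0" by auto
    with g show "\<omega> \<in> (\<Union>g\<in>N - {0}. T g)" by (auto simp: T_def intro!: bexI[of _ g])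
  qed
  then have "prob (space M - E) \<le> prob (\<Union>g\<in>N - {0}. T g)"
    using T N by (intro finite_measure_mono) auto
  also have "\<dots> \<le> (\<Sum>g\<in>N - {0}. prob (T g))"
    using T N by (intro finite_measure_subadditive_finite) auto
  also have "\<dots> \<le> (\<Sum>g\<in>N - {0}. 2 * exp (- (?n * \<epsilon>\<^sup>2 / (4 * a ^ 4))))"
    unfolding T_def
    by (intro sum_mono psi2_concentration[OF _ ind iso psi2 \<epsilon> a]) auto
  also have "\<dots> \<le> (\<Sum>g\<in>N. 2 * exp (- (?n * \<epsilon>\<^sup>2 / (4 * a ^ 4))))"
    using N by (intro sum_mono2) auto
  finally show "1 - 2 * card N * exp (- (?n * \<epsilon>\<^sup>2 / (4 * a ^ 4))) \<le> prob E"
    using E by (simp add: prob_compl mult_ac)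
qed

text \<open>One net is taken in the span of each choice of \<open>k\<close> columns, and the number
  of choices is a binomial coefficient. Supports with fewer than \<open>k\<close> elements are
  covered by enlarging them.\<close>

lemma sparse_image_net:
  fixes A :: "real ^ 'p ^ 'q" and \<delta> :: real
  assumes k: "0 < k" and \<delta>: "0 < \<delta>" "\<delta> < 1"
  obtains N where "finite N" "card N \<le> exp (k * ln (60 * exp 1 * CARD('p) / (k * \<delta>)))"
    "\<And>J. card J = k \<Longrightarrow> \<exists>N'\<subseteq>N. N' \<subseteq> span ((\<lambda>j. A *v axis j 1) ` J) \<and>
      (\<forall>u\<in>span ((\<lambda>j. A *v axis j 1) ` J). norm u \<le> 1 \<longrightarrow> (\<exists>g\<in>N'. norm g \<le> 1 \<and> norm (u - g) \<le> \<delta> / 10))"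
proof -
  let ?W = "\<lambda>J. span ((\<lambda>j. A *v axis j 1) ` J)"
  let ?c = "exp 1 * (1 + 2 / (\<delta> / 10)) :: real"
  let ?P = "\<lambda>J N'. finite N' \<and> N' \<subseteq> ?W J \<and> card N' \<le> ?c ^ k \<and>
      (\<forall>u\<in>?W J. norm u \<le> 1 \<longrightarrow> (\<exists>g\<in>N'. norm g \<le> 1 \<and> norm (u - g) \<le> \<delta> / 10))"
  have "\<exists>N'. ?P J N'" if J: "card J = k" for J
  proof -
    have "dim (?W J) \<le> card ((\<lambda>j. A *v axis j 1) ` J)"
      by (simp add: dim_le_card')
    also have "\<dots> \<le> k" using J card_image_le[of J "\<lambda>j. A *v axis j 1"] by simp
    finally obtain N' where "finite N'" "N' \<subseteq> ?W J" "card N' \<le> ?c ^ k"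
      "\<And>u. u \<in> ?W J \<Longrightarrow> norm u \<le> 1 \<Longrightarrow> \<exists>g\<in>N'. norm g \<le> 1 \<and> norm (u - g) \<le> \<delta> / 10"
      using subspace_net[OF subspace_span, of "(\<lambda>j. A *v axis j 1) ` J" k "\<delta> / 10"] \<delta> by auto
    then show ?thesis by blast
  qed
  then obtain net where net: "\<And>J. card J = k \<Longrightarrow> ?P J (net J)" by metis
  define \<J> where "\<J> = {J :: 'p set. card J = k}"
  have card\<J>: "card \<J> = CARD('p) choose k"
    using n_subsets[of "UNIV :: 'p set" k] by (simp add: \<J>_def)
  show thesis
  proof (rule that[of "\<Union>J\<in>\<J>. net J"])
    show "finite (\<Union>J\<in>\<J>. net J)" using net by (auto simp: \<J>_def)
    \<comment> \<open>Since \<open>\<delta> < 1\<close>, the base is at most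
      \<open>21 * exp 1 / \<delta>\<close>, and \<open>21 * exp 1 < 60\<close>; this yields the
      constant 60 in the logarithm.\<close>
    have "exp 1 * (1 + 20 / \<delta>) \<le> exp 1 * (21 / \<delta>)"
      using \<delta> by (intro mult_left_mono) (auto simp: field_simps)
    also have "\<dots> \<le> 60 / \<delta>"
      using \<delta> e_less_272 by (simp add: field_simps)
    finally have c: "?c \<le> 60 / \<delta>" by simp
    have "card (\<Union>J\<in>\<J>. net J) \<le> (\<Sum>J\<in>\<J>. card (net J))"
      by (intro card_UN_le) simp
    then have "real (card (\<Union>J\<in>\<J>. net J)) \<le> (\<Sum>J\<in>\<J>. real (card (net J)))"
      by (metis of_nat_le_iff of_nat_sum)
    also have "\<dots> \<le> (\<Sum>J\<in>\<J>. ?c ^ k)" using net by (intro sum_mono) (auto simp: \<J>_def)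
    also have "\<dots> = real (CARD('p) choose k) * ?c ^ k" by (simp add: card\<J>)
    also have "\<dots> \<le> real (CARD('p) choose k) * (60 / \<delta>) ^ k"
      using c \<delta> by (intro mult_left_mono power_mono) auto
    also have "\<dots> \<le> exp (k * ln (exp 1 * CARD('p) * (60 / \<delta>) / k))"
      using k \<delta> by (intro binomial_mult_power_le_exp) auto
    also have "exp 1 * CARD('p) * (60 / \<delta>) / k = 60 * exp 1 * CARD('p) / (k * \<delta>)"
      by (simp add: mult_ac)
    finally show "card (\<Union>J\<in>\<J>. net J) \<le> exp (k * ln (60 * exp 1 * CARD('p) / (k * \<delta>)))" .
    fix J :: "'p set" assume "card J = k"
    with net[of J] show "\<exists>N'\<subseteq>\<Union>J\<in>\<J>. net J. N' \<subseteq> ?W J \<and>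
      (\<forall>u\<in>?W J. norm u \<le> 1 \<longrightarrow> (\<exists>g\<in>N'. norm g \<le> 1 \<and> norm (u - g) \<le> \<delta> / 10))"
      by (intro exI[of _ "net J"]) (auto simp: \<J>_def)
  qed
qed

theorem theorem1p6:
  fixes A :: "real ^ 'p ^ 'q"
    and M :: "'w measure"
    and \<Psi> :: "'w \<Rightarrow> real ^ 'q ^ 'n"
    and \<delta> k\<^sub>0 \<alpha> d m :: real
    and s\<^sub>0 :: nat
  assumes "0 < \<delta>" "\<delta> < 1"
    and "0 < k\<^sub>0"
    and "0 < s\<^sub>0" "s\<^sub>0 < CARD('p)"
    and "RE s\<^sub>0 (3 * k\<^sub>0) A"
    and "d = real s\<^sub>0 + real s\<^sub>0 * (MAX j. (norm (A *v axis j 1))\<^sup>2)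
             * (16 * (RE_K s\<^sub>0 (3 * k\<^sub>0) A)\<^sup>2 * (3 * k\<^sub>0)\<^sup>2 * (3 * k\<^sub>0 + 1) / \<delta>\<^sup>2)"
    and "m = min d (real CARD('p))"
    and "prob_space M"
    and "prob_space.indep_vars M (\<lambda>_. borel) (\<lambda>i \<omega>. row i (\<Psi> \<omega>)) UNIV"
    and "\<And>i. isotropic M (\<lambda>\<omega>. row i (\<Psi> \<omega>))"
    and "\<And>i. psi2_vector M \<alpha> (\<lambda>\<omega>. row i (\<Psi> \<omega>))"
    and "real CARD('n) \<ge> 2000 * m * \<alpha> ^ 4 / \<delta>\<^sup>2 * ln (60 * exp 1 * real CARD('p) / (m * \<delta>))"
  shows "measure M {\<omega> \<in> space M.
             RE s\<^sub>0 k\<^sub>0 ((1 / sqrt (real CARD('n))) *\<^sub>R (\<Psi> \<omega> ** A))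
           \<and> 0 < RE_K s\<^sub>0 k\<^sub>0 ((1 / sqrt (real CARD('n))) *\<^sub>R (\<Psi> \<omega> ** A))
           \<and> RE_K s\<^sub>0 k\<^sub>0 ((1 / sqrt (real CARD('n))) *\<^sub>R (\<Psi> \<omega> ** A)) \<le> RE_K s\<^sub>0 k\<^sub>0 A / (1 - \<delta>)}
         \<ge> 1 - 2 * exp (- (\<delta>\<^sup>2 * real CARD('n) / (2000 * \<alpha> ^ 4)))"
proof -
  interpret prob_space M by fact
  note \<delta> = assms(1,2) and k0 = assms(3) and RE = assms(6) and d = assms(7) and m = assms(8)
    and ind = assms(10) and iso = assms(11) and psi2 = assms(12)
  let ?n = "real CARD('n)" and ?p = "real CARD('p)"
  let ?B = "\<lambda>\<omega>. (1 / sqrt ?n) *\<^sub>R (\<Psi> \<omega> ** A)"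
  define G where "G = {\<omega> \<in> space M. RE s\<^sub>0 k\<^sub>0 (?B \<omega>) \<and> 0 < RE_K s\<^sub>0 k\<^sub>0 (?B \<omega>)
    \<and> RE_K s\<^sub>0 k\<^sub>0 (?B \<omega>) \<le> RE_K s\<^sub>0 k\<^sub>0 A / (1 - \<delta>)}"
  have row_meas: "(\<lambda>\<omega>. row i (\<Psi> \<omega>)) \<in> borel_measurable M" for i
    using ind by (auto simp: indep_vars_def)
  then have \<alpha>: "1 \<le> \<alpha>"
    using iso psi2 by (rule psi2_vector_constant_ge_1)
  have s0: "0 < s\<^sub>0" by fact

  \<comment> \<open>Measurability permits the comparison \<open>prob E \<le> prob G\<close> from
    \<open>E \<subseteq> G\<close>; a non-measurable set would have measure 0.\<close>
  have G: "G \<in> sets M"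
  proof -
    have [measurable]: "\<Psi> \<in> borel_measurable M"
      by (rule borel_measurable_rows[OF row_meas])
    have "continuous_on UNIV (\<lambda>X :: real ^ 'q ^ 'n. (1 / sqrt ?n) *\<^sub>R (X ** A))"
      unfolding matrix_matrix_mult_def by (intro continuous_intros)
    then have [measurable]: "(\<lambda>X :: real ^ 'q ^ 'n. (1 / sqrt ?n) *\<^sub>R (X ** A)) \<in> borel_measurable borel"
      by (rule borel_measurable_continuous_onI)
    have [measurable]: "?B \<in> borel_measurable M" by measurable
    have [measurable]: "(RE_min s\<^sub>0 k\<^sub>0 :: real ^ 'p ^ 'n \<Rightarrow> real) \<in> borel_measurable borel"
      using s0 k0 by (intro borel_measurable_RE_min) auto
    show ?thesis unfolding G_def RE_def RE_K_def by measurable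
  qed

  define k where "k = nat \<lceil>m\<rceil>"
  have m1: "1 \<le> m"
  proof -
    have "0 \<le> (MAX j. (norm (A *v axis j 1))\<^sup>2)"
      by (rule order_trans[OF zero_le_power2 Max_ge]) auto
    then have "real s\<^sub>0 \<le> d" unfolding d using k0 by simp
    moreover have "1 \<le> real s\<^sub>0" "real s\<^sub>0 \<le> ?p" using assms(4,5) by auto
    ultimately show ?thesis by (simp add: m)
  qed
  \<comment> \<open>Rounding up at most doubles \<open>m\<close>, because
    \<open>m \<ge> 1\<close>.\<close>
  have k: "0 < k" "m \<le> real k" "real k \<le> 2 * m" using m1 by (auto simp: k_def) linarith+
  have kp: "k \<le> CARD('p)" by (simp add: k_def m)

  obtain N where N: "finite N" "card N \<le> exp (k * ln (60 * exp 1 * ?p / (k * \<delta>)))"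
    "\<And>J. card J = k \<Longrightarrow> \<exists>N'\<subseteq>N. N' \<subseteq> span ((\<lambda>j. A *v axis j 1) ` J) \<and>
      (\<forall>u\<in>span ((\<lambda>j. A *v axis j 1) ` J). norm u \<le> 1 \<longrightarrow> (\<exists>g\<in>N'. norm g \<le> 1 \<and> norm (u - g) \<le> \<delta> / 10))"
    using sparse_image_net[OF k(1) \<delta>, of A] by auto
  define E where "E = {\<omega> \<in> space M. \<forall>g\<in>N.
    \<bar>(norm ((1 / sqrt ?n) *\<^sub>R (\<Psi> \<omega> *v g)))\<^sup>2 - (norm g)\<^sup>2\<bar> \<le> \<delta> / 4 * (norm g)\<^sup>2}"
  \<comment> \<open>Any number above \<open>\<alpha>\<close> would do for \<open>11 / 10 * \<alpha>\<close>: the \<open>\<psi>\<^sub>2\<close>-norm is an infimum that need not be admissible.\<close>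
  have E: "1 - 2 * card N * exp (- (?n * (\<delta> / 4)\<^sup>2 / (4 * (11 / 10 * \<alpha>) ^ 4))) \<le> prob E"
    unfolding E_def using \<delta> \<alpha> N(1)
    by (intro psi2_matrix_almost_isometry_on_finite(2)[OF ind iso psi2]) auto

  have "E \<subseteq> G"
  proof
    fix \<omega> assume \<omega>: "\<omega> \<in> E"
    define F where "F u = (1 / sqrt ?n) *\<^sub>R (\<Psi> \<omega> *v u)" for u
    have F: "linear F" unfolding F_def by (intro linear_compose_scale_right) simp
    have BF: "?B \<omega> *v v = F (A *v v)" for v
      by (simp add: F_def matrix_vector_mul_assoc scaleR_matrix_vector_assoc)
    have iso: "(1 - 19 / 40 * \<delta>) * norm (A *v v) \<le> norm (?B \<omega> *v v)"
        "norm (?B \<omega> *v v) \<le> 5 / 4 * norm (A *v v)" if v: "card {i. v $ i \<noteq> 0} \<le> k" for v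
    proof -
      \<comment> \<open>The nets belong to index sets of size exactly \<open>k\<close>, so the
        support is enlarged to that size, which \<open>kp\<close> makes possible.\<close>
      obtain J where J: "{i. v $ i \<noteq> 0} \<subseteq> J" "card J = k"
        using exists_subset_between[OF v, of UNIV] kp by auto
      let ?W = "span ((\<lambda>j. A *v axis j 1) ` J)"
      obtain N' where N': "N' \<subseteq> N" "N' \<subseteq> ?W"
        "\<And>u. u \<in> ?W \<Longrightarrow> norm u \<le> 1 \<Longrightarrow> \<exists>g\<in>N'. norm g \<le> 1 \<and> norm (u - g) \<le> \<delta> / 10"
        using N(3)[OF J(2)] by blast
      have "\<bar>(norm (F g))\<^sup>2 - (norm g)\<^sup>2\<bar> \<le> \<delta> / 4 * (norm g)\<^sup>2" if "g \<in> N'" for g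
        using \<omega> that N'(1) unfolding E_def F_def by blast
      from net_almost_isometry[OF F subspace_span \<delta> N'(3,2) this matrix_vector_sparse_in_span[OF J(1)]]
      show "(1 - 19 / 40 * \<delta>) * norm (A *v v) \<le> norm (?B \<omega> *v v)"
        "norm (?B \<omega> *v v) \<le> 5 / 4 * norm (A *v v)"
        unfolding BF by auto
    qed
    have "norm (?B \<omega> *v axis j 1) \<le> 5 / 4 * norm (A *v axis j 1)" for j
    proof (rule iso(2))
      have "card {i. axis j (1 :: real) $ i \<noteq> 0} = card {j}" by (simp add: axis_def)
      then show "card {i. axis j (1 :: real) $ i \<noteq> 0} \<le> k" using k(1) by simp
    qed
    from RE_reduction[OF \<delta> k0 RE d iso(1)[unfolded k_def m] this]
    have "(1 - \<delta>) * RE_min s\<^sub>0 k\<^sub>0 A \<le> RE_min s\<^sub>0 k\<^sub>0 (?B \<omega>)"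
      using s0 k0 \<delta> by (intro RE_min_scale_le) auto
    moreover have "0 < RE_min s\<^sub>0 k\<^sub>0 A"
      using RE RE_min_antimono[of s\<^sub>0 k\<^sub>0 "3 * k\<^sub>0" A] s0 k0 by (simp add: RE_def)
    then have "0 < (1 - \<delta>) * RE_min s\<^sub>0 k\<^sub>0 A" using \<delta> by simp
    ultimately show "\<omega> \<in> G"
      using \<omega> s0 k0 assms(5) frac_le[of 1 1 "(1 - \<delta>) * RE_min s\<^sub>0 k\<^sub>0 A" "RE_min s\<^sub>0 k\<^sub>0 (?B \<omega>)"]
      by (simp add: G_def E_def RE_def RE_K_def mult.commute)
  qed
  then have "prob E \<le> prob G" using G by (rule finite_measure_mono)

  \<comment> \<open>\<open>T\<close> is the exponent of the asserted probability; the lower bound on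
    the number of rows says precisely \<open>m * ?l m \<le> T\<close>.\<close>
  define T where "T = \<delta>\<^sup>2 * ?n / (2000 * \<alpha> ^ 4)"
  let ?l = "\<lambda>x. ln (60 * exp 1 * ?p / (x * \<delta>))"
  have T: "0 \<le> T" by (simp add: T_def)
  have mT: "m * ?l m \<le> T"
    using assms(13) \<delta> \<alpha> by (simp add: T_def field_simps)
  \<comment> \<open>The logarithm decreases in its argument and \<open>k \<le> 2 * m\<close>, so
    rounding costs a factor 2. Multiplying the two estimates requires the logarithm at
    \<open>k\<close> to be nonnegative.\<close>
  have "real k * ?l k \<le> 2 * m * ?l m"
  proof -
    have "k * \<delta> \<le> ?p * 1" using kp \<delta> by (intro mult_mono) auto
    moreover have "1 * 1 \<le> 60 * exp (1 :: real)" by (intro mult_mono) auto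
    then have "1 * ?p \<le> 60 * exp 1 * ?p" by (intro mult_right_mono) auto
    ultimately have "k * \<delta> \<le> 60 * exp 1 * ?p" by linarith
    then have "1 \<le> 60 * exp 1 * ?p / (k * \<delta>)" using k \<delta> by simp
    then have l0: "0 \<le> ?l k" by (rule ln_ge_zero)
    have "?l k \<le> ?l m"
      using k m1 \<delta> kp by (intro ln_mono divide_left_mono mult_right_mono) auto
    with l0 k m1 show ?thesis by (intro mult_mono) auto
  qed
  with mT have "real k * ?l k \<le> 2 * T" by linarith
  then have "card N \<le> exp (2 * T)" using N(2) by (meson exp_le_cancel_iff order_trans)
  \<comment> \<open>The tail exponent has denominator \<open>64 * (11 / 10) ^ 4 < 94\<close> before
    \<open>\<alpha> ^ 4\<close>, well below the \<open>2000 / 3\<close> of \<open>3 * T\<close>. The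
    net costs \<open>2 * T\<close>, so \<open>T\<close> remains.\<close>
  then have "card N * exp (- (?n * (\<delta> / 4)\<^sup>2 / (4 * (11 / 10 * \<alpha>) ^ 4)))
      \<le> exp (2 * T) * exp (- (3 * T))"
  proof (intro mult_mono)
    have "3 * T \<le> ?n * (\<delta> / 4)\<^sup>2 / (4 * (11 / 10 * \<alpha>) ^ 4)"
      using \<alpha> by (simp add: T_def power_mult_distrib power_divide field_simps)
    then show "exp (- (?n * (\<delta> / 4)\<^sup>2 / (4 * (11 / 10 * \<alpha>) ^ 4))) \<le> exp (- (3 * T))" by simp
  qed auto
  also have "\<dots> = exp (- T)" by (simp flip: exp_add)
  finally have "1 - 2 * exp (- T) \<le> prob E" using E by linarith
  with \<open>prob E \<le> prob G\<close> show ?thesis unfolding T_def G_def by linarith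
qed

end
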